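(* Let $n\ge2$ and $X\in M(n,\mathbb{C})$ with $\|X\|=1$. Then $$\lambda_1(T_X)+\lambda_3(T_X)\le\frac{4+\sqrt{10}}{2}.$$
   Context: $M(n,\mathbb{C})$ is the space of complex $n\times n$ matrices, $X^*$ is the conjugate transpose, $\|X\|=\sqrt{\operatorname{Tr}XX^*}$ is the Frobenius norm, and $[X,Y]=XY-YX$. $T_X$ is the linear map on $M(n,\mathbb{C})$ given by $T_X(Y)=[X^*,[X,Y]]$; it is self-adjoint and positive semi-definite for $\langle Y,Z\rangle=\operatorname{Tr}(YZ^* )$, and $\lambda_1(T_X)\ge\lambda_2(T_X)\ge\cdots\ge\lambda_{n^2}(T_X)$ are its eigenvalues counted with multiplicity. *)

theory Defs
  imports "Jordan_Normal_Form.Schur_Decomposition"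
begin

definition mat_trace :: "complex mat \<Rightarrow> complex" where
  "mat_trace A = (\<Sum>i<dim_row A. A $$ (i, i))"

definition frobenius_norm :: "complex mat \<Rightarrow> real" where
  "frobenius_norm X = sqrt (Re (mat_trace (X * mat_adjoint X)))"

definition commutator :: "complex mat \<Rightarrow> complex mat \<Rightarrow> complex mat" where
  "commutator X Y = X * Y - Y * X"

definition T_op :: "complex mat \<Rightarrow> complex mat \<Rightarrow> complex mat" where
  "T_op X Y = commutator (mat_adjoint X) (commutator X Y)"

definition unit_matrix :: "nat \<Rightarrow> nat \<Rightarrow> complex mat" where
  "unit_matrix n c = mat n n (\<lambda>(i, j). if i = c div n \<and> j = c mod n then 1 else 0)"

definition vectorize :: "nat \<Rightarrow> complex mat \<Rightarrow> complex vec" where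
  "vectorize n Y = vec (n * n) (\<lambda>r. Y $$ (r div n, r mod n))"

text \<open>The matrix of a linear map on the \<open>n \<times> n\<close> matrices with respect to the standard basis
  \<open>unit_matrix n c\<close>, \<open>c < n * n\<close>, which lists the matrix units row by row.\<close>

definition matrix_of_op :: "nat \<Rightarrow> (complex mat \<Rightarrow> complex mat) \<Rightarrow> complex mat" where
  "matrix_of_op n L =
     mat (n * n) (n * n) (\<lambda>(r, c). vectorize n (L (unit_matrix n c)) $ r)"

text \<open>The eigenvalues of a linear map on the \<open>n \<times> n\<close> matrices, with multiplicity (as roots of the
  characteristic polynomial) and in decreasing order. This is only meant for maps all of whose
  eigenvalues are real, so that \<open>Re\<close> loses nothing; for \<open>T_op X\<close> this is
  \<open>char_poly_T_op\<close> below.\<close>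

definition eigenvalues_desc :: "nat \<Rightarrow> (complex mat \<Rightarrow> complex mat) \<Rightarrow> real list" where
  "eigenvalues_desc n L =
     rev (sorted_list_of_multiset (image_mset Re (proots (char_poly (matrix_of_op n L)))))"

text \<open>Indices start at \<open>1\<close>: \<open>eigenvalue_T n X 1\<close> is the largest eigenvalue.\<close>

definition eigenvalue_T :: "nat \<Rightarrow> complex mat \<Rightarrow> nat \<Rightarrow> real" where
  "eigenvalue_T n X k = eigenvalues_desc n (T_op X) ! (k - 1)"

lemma adjoint_index:
  assumes "A \<in> carrier_mat n n" "i < n" "j < n"
  shows "mat_adjoint A $$ (i, j) = cnj (A $$ (j, i))"
  using assms unfolding mat_adjoint_def by (auto simp: mat_of_rows_def)

lemma adjoint_carrier:
  assumes "A \<in> carrier_mat n n" shows "mat_adjoint A \<in> carrier_mat n n"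
  using assms unfolding mat_adjoint_def by (auto simp: mat_of_rows_def)

lemma commutator_carrier:
  assumes "X \<in> carrier_mat n n" "Y \<in> carrier_mat n n"
  shows "commutator X Y \<in> carrier_mat n n"
  using assms unfolding commutator_def by (auto intro: minus_carrier_mat)

lemma T_op_carrier:
  assumes "X \<in> carrier_mat n n" "Y \<in> carrier_mat n n"
  shows "T_op X Y \<in> carrier_mat n n"
  using assms unfolding T_op_def by (intro commutator_carrier adjoint_carrier)

lemma commutator_index:
  assumes "X \<in> carrier_mat n n" "Y \<in> carrier_mat n n" "i < n" "j < n"
  shows "commutator X Y $$ (i, j) =
    (\<Sum>k<n. X $$ (i, k) * Y $$ (k, j)) - (\<Sum>k<n. Y $$ (i, k) * X $$ (k, j))"
  using assms unfolding commutator_def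
  by (auto simp: scalar_prod_def lessThan_atLeast0)

lemma sum_div_mod:
  fixes f :: "nat \<Rightarrow> nat \<Rightarrow> complex"
  shows "(\<Sum>c<n * n. f (c div n) (c mod n)) = (\<Sum>k<n. \<Sum>l<n. f k l)"
proof -
  have "(\<Sum>k<n. \<Sum>l<n. f k l) = (\<Sum>(k, l)\<in>{..<n} \<times> {..<n}. f k l)"
    by (simp add: sum.cartesian_product)
  also have "\<dots> = (\<Sum>c<n * n. f (c div n) (c mod n))"
  proof (rule sum.reindex_bij_witness[where j = "\<lambda>(k, l). k * n + l"
        and i = "\<lambda>c. (c div n, c mod n)"])
    fix p assume "p \<in> {..<n} \<times> {..<n}"
    then obtain k l where p: "p = (k, l)" "k < n" "l < n" by auto
    have "k * n + l < Suc k * n" using p by simp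
    also have "\<dots> \<le> n * n" using p by (intro mult_right_mono) auto
    finally show "(case p of (k, l) \<Rightarrow> k * n + l) \<in> {..<n * n}" using p by simp
  qed (auto simp: less_mult_imp_div_less, (metis mult_zero_right not_less_zero gr0I mod_less_divisor)?)
  finally show ?thesis by simp
qed

definition coeffs_of_op ::
    "nat \<Rightarrow> (complex mat \<Rightarrow> complex mat) \<Rightarrow> (nat \<Rightarrow> nat \<Rightarrow> nat \<Rightarrow> nat \<Rightarrow> complex) \<Rightarrow> bool" where
  "coeffs_of_op n L a \<longleftrightarrow> (\<forall>Y\<in>carrier_mat n n. L Y \<in> carrier_mat n n \<and>
     (\<forall>i<n. \<forall>j<n. L Y $$ (i, j) = (\<Sum>k<n. \<Sum>l<n. a i j k l * Y $$ (k, l))))"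

lemma coeffs_commutator:
  assumes X: "X \<in> carrier_mat n n"
  shows "coeffs_of_op n (commutator X)
    (\<lambda>i j k l. (if l = j then X $$ (i, k) else 0) - (if k = i then X $$ (l, j) else 0))"
  unfolding coeffs_of_op_def
proof (intro ballI conjI allI impI)
  fix Y :: "complex mat" and i j assume Y: "Y \<in> carrier_mat n n" and ij: "i < n" "j < n"
  have 1: "(\<Sum>k<n. \<Sum>l<n. (if l = j then X $$ (i, k) else 0) * Y $$ (k, l)) =
      (\<Sum>k<n. X $$ (i, k) * Y $$ (k, j))"
    using ij by (intro sum.cong) (auto simp: if_distrib[of "\<lambda>x. x * _"] cong: if_cong)
  have "(\<Sum>k<n. \<Sum>l<n. (if k = i then X $$ (l, j) else 0) * Y $$ (k, l)) =
      (\<Sum>l<n. \<Sum>k<n. if k = i then Y $$ (i, l) * X $$ (l, j) else 0)"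
    by (subst sum.swap, intro sum.cong) auto
  also have "\<dots> = (\<Sum>l<n. Y $$ (i, l) * X $$ (l, j))"
    using ij by (intro sum.cong) auto
  finally have 2: "(\<Sum>k<n. \<Sum>l<n. (if k = i then X $$ (l, j) else 0) * Y $$ (k, l)) =
      (\<Sum>l<n. Y $$ (i, l) * X $$ (l, j))" .
  show "commutator X Y $$ (i, j) = (\<Sum>k<n. \<Sum>l<n.
     ((if l = j then X $$ (i, k) else 0) - (if k = i then X $$ (l, j) else 0)) * Y $$ (k, l))"
    unfolding left_diff_distrib sum_subtractf 1 2 by (rule commutator_index[OF X Y ij])
qed (use X in \<open>simp add: commutator_carrier\<close>)

lemma coeffs_comp:
  assumes L: "coeffs_of_op n L a" and M: "coeffs_of_op n M b"
  shows "coeffs_of_op n (\<lambda>Y. L (M Y))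
    (\<lambda>i j k l. \<Sum>p<n. \<Sum>q<n. a i j p q * b p q k l)"
  unfolding coeffs_of_op_def
proof (intro ballI conjI allI impI)
  fix Y :: "complex mat" and i j assume Y: "Y \<in> carrier_mat n n" and ij: "i < n" "j < n"
  have MY: "M Y \<in> carrier_mat n n" using M Y unfolding coeffs_of_op_def by auto
  have "L (M Y) $$ (i, j) = (\<Sum>p<n. \<Sum>q<n. a i j p q * M Y $$ (p, q))"
    using L MY ij unfolding coeffs_of_op_def by auto
  also have "\<dots> = (\<Sum>p<n. \<Sum>q<n. \<Sum>k<n. \<Sum>l<n. a i j p q * b p q k l * Y $$ (k, l))"
    using M Y unfolding coeffs_of_op_def
    by (intro sum.cong) (auto simp: sum_distrib_left mult.assoc)
  also have "\<dots> = (\<Sum>(p, q)\<in>{..<n} \<times> {..<n}. \<Sum>(k, l)\<in>{..<n} \<times> {..<n}.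
      a i j p q * b p q k l * Y $$ (k, l))"
    by (simp flip: sum.cartesian_product)
  also have "\<dots> = (\<Sum>(k, l)\<in>{..<n} \<times> {..<n}. \<Sum>(p, q)\<in>{..<n} \<times> {..<n}.
      a i j p q * b p q k l * Y $$ (k, l))"
    unfolding case_prod_unfold by (rule sum.swap)
  also have "\<dots> = (\<Sum>k<n. \<Sum>l<n. (\<Sum>p<n. \<Sum>q<n. a i j p q * b p q k l) * Y $$ (k, l))"
    by (simp add: sum.cartesian_product[symmetric] sum_distrib_right)
  finally show "L (M Y) $$ (i, j) =
    (\<Sum>k<n. \<Sum>l<n. (\<Sum>p<n. \<Sum>q<n. a i j p q * b p q k l) * Y $$ (k, l))" .
qed (use L M in \<open>auto simp: coeffs_of_op_def\<close>)

lemma matrix_of_op_coeffs: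
  assumes L: "coeffs_of_op n L a" and Y: "Y \<in> carrier_mat n n"
  shows "matrix_of_op n L *\<^sub>v vectorize n Y = vectorize n (L Y)"
proof (rule eq_vecI)
  show "dim_vec (matrix_of_op n L *\<^sub>v vectorize n Y) = dim_vec (vectorize n (L Y))"
    by (simp add: matrix_of_op_def vectorize_def)
next
  fix r assume "r < dim_vec (vectorize n (L Y))"
  then have r: "r < n * n" by (simp add: vectorize_def)
  then have n: "n > 0" by (cases n) auto
  have r': "r div n < n" "r mod n < n" using r n by (auto simp: less_mult_imp_div_less)
  have entry: "L (unit_matrix n c) $$ (r div n, r mod n) = a (r div n) (r mod n) (c div n) (c mod n)"
    if c: "c < n * n" for c
  proof -
    have c': "c div n < n" "c mod n < n" using c n by (auto simp: less_mult_imp_div_less)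
    have "L (unit_matrix n c) $$ (r div n, r mod n) =
        (\<Sum>k<n. \<Sum>l<n. a (r div n) (r mod n) k l * unit_matrix n c $$ (k, l))"
      using L r' unfolding coeffs_of_op_def by (simp add: unit_matrix_def)
    also have "\<dots> = (\<Sum>k<n. \<Sum>l<n. if k = c div n then
        if l = c mod n then a (r div n) (r mod n) k l else 0 else 0)"
      by (intro sum.cong) (auto simp: unit_matrix_def)
    also have "\<dots> = (\<Sum>k<n. if k = c div n then a (r div n) (r mod n) k (c mod n) else 0)"
      using c' by (intro sum.cong) auto
    finally show ?thesis using c' by simp
  qed
  have "(matrix_of_op n L *\<^sub>v vectorize n Y) $ r =
      (\<Sum>c<n * n. a (r div n) (r mod n) (c div n) (c mod n) * Y $$ (c div n, c mod n))"
    using r entry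
    by (auto simp: matrix_of_op_def vectorize_def scalar_prod_def lessThan_atLeast0 intro!: sum.cong)
  also have "\<dots> = L Y $$ (r div n, r mod n)"
    using L Y r' unfolding coeffs_of_op_def
    by (simp add: sum_div_mod[of "\<lambda>k l. a (r div n) (r mod n) k l * Y $$ (k, l)"])
  finally show "(matrix_of_op n L *\<^sub>v vectorize n Y) $ r = vectorize n (L Y) $ r"
    using r by (simp add: vectorize_def)
qed

text \<open>\<open>matrix_of_op\<close> represents \<open>T_op X\<close> in the coordinates \<open>vectorize n\<close>.\<close>

lemma matrix_of_op_T_op:
  assumes "X \<in> carrier_mat n n" "Y \<in> carrier_mat n n"
  shows "matrix_of_op n (T_op X) *\<^sub>v vectorize n Y = vectorize n (T_op X Y)"
  unfolding T_op_def
  by (rule matrix_of_op_coeffs[OF coeffs_comp[OF coeffs_commutator coeffs_commutator]])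
    (use assms adjoint_carrier in auto)

definition inner_mat :: "nat \<Rightarrow> complex mat \<Rightarrow> complex mat \<Rightarrow> complex" where
  "inner_mat n Y Z = (\<Sum>i<n. \<Sum>j<n. Y $$ (i, j) * cnj (Z $$ (i, j)))"

lemma inner_mat_adjoint:
  assumes X: "X \<in> carrier_mat n n" and Y: "Y \<in> carrier_mat n n" and Z: "Z \<in> carrier_mat n n"
  shows "inner_mat n (commutator (mat_adjoint X) Z) Y = inner_mat n Z (commutator X Y)"
proof -
  have 1: "(\<Sum>i<n. \<Sum>j<n. \<Sum>k<n. cnj (X $$ (k, i)) * Z $$ (k, j) * cnj (Y $$ (i, j))) =
      (\<Sum>i<n. \<Sum>j<n. \<Sum>k<n. Z $$ (i, j) * (cnj (X $$ (i, k)) * cnj (Y $$ (k, j))))" (is "?l = ?r")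
  proof -
    have "?l = (\<Sum>j<n. \<Sum>i<n. \<Sum>k<n. cnj (X $$ (k, i)) * Z $$ (k, j) * cnj (Y $$ (i, j)))"
      by (rule sum.swap)
    also have "\<dots> = (\<Sum>j<n. \<Sum>k<n. \<Sum>i<n. cnj (X $$ (k, i)) * Z $$ (k, j) * cnj (Y $$ (i, j)))"
      by (intro sum.cong refl sum.swap)
    also have "\<dots> = (\<Sum>k<n. \<Sum>j<n. \<Sum>i<n. cnj (X $$ (k, i)) * Z $$ (k, j) * cnj (Y $$ (i, j)))"
      by (rule sum.swap)
    finally show ?thesis by (simp add: mult_ac)
  qed
  have 2: "(\<Sum>i<n. \<Sum>j<n. \<Sum>k<n. Z $$ (i, k) * cnj (X $$ (j, k)) * cnj (Y $$ (i, j))) =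
      (\<Sum>i<n. \<Sum>j<n. \<Sum>k<n. Z $$ (i, j) * (cnj (Y $$ (i, k)) * cnj (X $$ (k, j))))" (is "?l = ?r")
  proof -
    have "?l = (\<Sum>i<n. \<Sum>k<n. \<Sum>j<n. Z $$ (i, k) * cnj (X $$ (j, k)) * cnj (Y $$ (i, j)))"
      by (intro sum.cong refl sum.swap)
    then show ?thesis by (simp add: mult_ac)
  qed
  have "inner_mat n (commutator (mat_adjoint X) Z) Y =
    (\<Sum>i<n. \<Sum>j<n. ((\<Sum>k<n. cnj (X $$ (k, i)) * Z $$ (k, j)) -
        (\<Sum>k<n. Z $$ (i, k) * cnj (X $$ (j, k)))) * cnj (Y $$ (i, j)))"
    unfolding inner_mat_def
    by (intro sum.cong refl, subst commutator_index[OF adjoint_carrier[OF X] Z])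
      (auto simp: adjoint_index[OF X])
  also have "\<dots> = (\<Sum>i<n. \<Sum>j<n. \<Sum>k<n. cnj (X $$ (k, i)) * Z $$ (k, j) * cnj (Y $$ (i, j))) -
      (\<Sum>i<n. \<Sum>j<n. \<Sum>k<n. Z $$ (i, k) * cnj (X $$ (j, k)) * cnj (Y $$ (i, j)))"
    by (simp add: left_diff_distrib sum_subtractf sum_distrib_right)
  also have "\<dots> = (\<Sum>i<n. \<Sum>j<n. Z $$ (i, j) * cnj (commutator X Y $$ (i, j)))"
    unfolding 1 2
    by (simp add: commutator_index[OF X Y] sum_distrib_left right_diff_distrib
        flip: sum_subtractf)
  finally show ?thesis by (simp add: inner_mat_def)
qed

lemma inner_mat_self:
  "inner_mat n Y Y = of_real (\<Sum>i<n. \<Sum>j<n. (cmod (Y $$ (i, j)))\<^sup>2)"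
  unfolding inner_mat_def complex_norm_square[symmetric] by simp

lemma root_char_poly_T_op:
  assumes X: "X \<in> carrier_mat n n" and root: "poly (char_poly (matrix_of_op n (T_op X))) z = 0"
  shows "z = of_real (Re z)" "Re z \<ge> 0"
proof -
  let ?M = "matrix_of_op n (T_op X)"
  have M: "?M \<in> carrier_mat (n * n) (n * n)" by (simp add: matrix_of_op_def)
  obtain v where v: "v \<in> carrier_vec (n * n)" "v \<noteq> 0\<^sub>v (n * n)" "?M *\<^sub>v v = z \<cdot>\<^sub>v v"
    using root M eigenvalue_root_char_poly[OF M] unfolding eigenvalue_def eigenvector_def by auto
  define Y where "Y = mat n n (\<lambda>(i, j). v $ (i * n + j))"
  have Y: "Y \<in> carrier_mat n n" by (simp add: Y_def)
  have idx: "i * n + j < n * n" if "i < n" "j < n" for i j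
  proof -
    have "i * n + j < Suc i * n" using that by simp
    also have "\<dots> \<le> n * n" using that by (intro mult_right_mono) auto
    finally show ?thesis .
  qed
  have vY: "v = vectorize n Y"
  proof (rule eq_vecI)
    fix r assume "r < dim_vec (vectorize n Y)"
    then have r: "r < n * n" by (simp add: vectorize_def)
    then have "n > 0" by (cases n) auto
    then show "v $ r = vectorize n Y $ r"
      using r by (simp add: vectorize_def Y_def less_mult_imp_div_less)
  qed (use v in \<open>auto simp: vectorize_def\<close>)
  have TY: "T_op X Y $$ (i, j) = z * Y $$ (i, j)" if "i < n" "j < n" for i j
  proof -
    have "vectorize n (T_op X Y) = z \<cdot>\<^sub>v vectorize n Y"
      using v(3) matrix_of_op_T_op[OF X Y] vY by simp
    then have "vectorize n (T_op X Y) $ (i * n + j) = (z \<cdot>\<^sub>v vectorize n Y) $ (i * n + j)"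
      by simp
    then show ?thesis using idx[OF that] that by (simp add: vectorize_def)
  qed
  define s where "s = (\<Sum>i<n. \<Sum>j<n. (cmod (Y $$ (i, j)))\<^sup>2)"
  define t where "t = (\<Sum>i<n. \<Sum>j<n. (cmod (commutator X Y $$ (i, j)))\<^sup>2)"
  have "z * inner_mat n Y Y = inner_mat n (T_op X Y) Y"
    by (simp add: inner_mat_def TY sum_distrib_left mult.assoc)
  also have "\<dots> = inner_mat n (commutator X Y) (commutator X Y)"
    unfolding T_op_def by (rule inner_mat_adjoint[OF X Y commutator_carrier[OF X Y]])
  finally have eq: "z * of_real s = of_real t"
    unfolding inner_mat_self s_def t_def .
  have "s \<noteq> 0"
  proof
    assume s0: "s = 0"
    have "Y $$ (i, j) = 0" if "i < n" "j < n" for i j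
    proof -
      have "(\<Sum>j<n. (cmod (Y $$ (i, j)))\<^sup>2) = 0"
        using s0 that unfolding s_def by (subst (asm) sum_nonneg_eq_0_iff) (auto intro: sum_nonneg)
      then show ?thesis using that by (subst (asm) sum_nonneg_eq_0_iff) auto
    qed
    then have "v = 0\<^sub>v (n * n)"
      unfolding vY vectorize_def
      by (intro eq_vecI) (auto, metis gr0I less_mult_imp_div_less mod_less_divisor mult_0_right not_less_zero)
    with v show False by simp
  qed
  moreover have st: "s \<ge> 0" "t \<ge> 0" unfolding s_def t_def by (auto intro!: sum_nonneg)
  ultimately have z: "z = of_real (t / s)" using eq by (simp add: field_simps)
  show "z = of_real (Re z)" "Re z \<ge> 0" using st by (simp_all add: z)
qed

lemma char_poly_T_op:
  assumes X: "X \<in> carrier_mat n n"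
  shows "char_poly (matrix_of_op n (T_op X)) =
      (\<Prod>x\<leftarrow>eigenvalues_desc n (T_op X). [:- of_real x, 1:])"
    and "length (eigenvalues_desc n (T_op X)) = n * n"
    and "\<forall>x\<in>set (eigenvalues_desc n (T_op X)). 0 \<le> x"
    and "sorted_wrt (\<ge>) (eigenvalues_desc n (T_op X))"
proof -
  let ?M = "matrix_of_op n (T_op X)" and ?es = "eigenvalues_desc n (T_op X)"
  have M: "?M \<in> carrier_mat (n * n) (n * n)" by (simp add: matrix_of_op_def)
  obtain as where as: "char_poly ?M = (\<Prod>a\<leftarrow>as. [:- a, 1:])" "length as = n * n"
    using char_poly_factorized[OF M] by auto
  have proots_as: "proots (\<Prod>a\<leftarrow>bs. [:- a, 1:]) = mset bs" for bs :: "complex list"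
  proof (induction bs)
    case (Cons b bs)
    have "(\<Prod>a\<leftarrow>bs. [:- a, 1:]) \<noteq> 0" by (auto simp: prod_list_zero_iff)
    then show ?case using Cons by (simp add: proots_mult del: mult_pCons_left)
  qed simp
  have real: "a = of_real (Re a)" "0 \<le> Re a" if "a \<in> set as" for a
    using root_char_poly_T_op[OF X, of a] that linear_poly_root[OF that] as by auto
  have es: "mset ?es = image_mset Re (mset as)"
    unfolding eigenvalues_desc_def as proots_as by simp
  have "(\<Prod>x\<leftarrow>?es. [:- complex_of_real x, 1:]) = prod_mset (image_mset (\<lambda>x. [:- complex_of_real x, 1:]) (mset ?es))"
    by (simp add: prod_mset_prod_list[symmetric])
  also have "\<dots> = prod_mset (image_mset (\<lambda>a. [:- a, 1:]) (mset as))"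
    unfolding es using real(1) by (auto simp: image_mset.compositionality o_def intro!: arg_cong[where f = prod_mset] image_mset_cong)
  also have "\<dots> = char_poly ?M" unfolding as by (simp add: prod_mset_prod_list[symmetric])
  finally show "char_poly ?M = (\<Prod>x\<leftarrow>?es. [:- of_real x, 1:])" by simp
  show "length ?es = n * n" using arg_cong[OF es, of size] as by simp
  show "\<forall>x\<in>set ?es. 0 \<le> x" using arg_cong[OF es, of set_mset] real(2) by auto
  show "sorted_wrt (\<ge>) ?es"
    unfolding eigenvalues_desc_def by (simp add: sorted_wrt_rev)
qed

lemma frobenius_norm_eq:
  assumes X: "X \<in> carrier_mat n n"
  shows "frobenius_norm X = sqrt (\<Sum>i<n. \<Sum>j<n. (cmod (X $$ (i, j)))\<^sup>2)"
proof -
  have "mat_trace (X * mat_adjoint X) = inner_mat n X X"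
    using X adjoint_carrier[OF X] unfolding mat_trace_def inner_mat_def
    by (auto simp: scalar_prod_def adjoint_index[OF X] lessThan_atLeast0 intro!: sum.cong)
  then show ?thesis unfolding frobenius_norm_def inner_mat_self by simp
qed

end

theory Submission
  imports Defs
begin

text \<open>
  Write \<open>\<lambda>\<^sub>1 \<ge> \<lambda>\<^sub>2 \<ge> \<dots>\<close> for the eigenvalues of \<open>T\<^sub>X\<close>. The quadratic form of \<open>T\<^sub>X\<close> is
  \<open>\<langle>T\<^sub>X Y, Y\<rangle> = \<parallel>[X, Y]\<parallel>\<^sup>2 = \<parallel>X Y\<parallel>\<^sup>2 + \<parallel>Y X\<parallel>\<^sup>2 - 2 Re \<langle>X Y X\<^sup>*, Y\<rangle>\<close>.
  The proof combines three facts.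

  First, the eigenvalues come in pairs: \<open>\<lambda>\<^sub>1 = \<lambda>\<^sub>2\<close> and \<open>\<lambda>\<^sub>3 = \<lambda>\<^sub>4\<close>. This holds since
  \<open>J Y = [X, Y]\<^sup>*\<close> is conjugate-linear with \<open>J\<^sup>2 = - T\<^sub>X\<close>, up to scaling a quaternionic structure on each eigenspace of a
  nonzero eigenvalue (\<open>T_op_eigenvalues_pair\<close>).

  Second, the part \<open>\<parallel>X Y\<parallel>\<^sup>2 + \<parallel>Y X\<parallel>\<^sup>2\<close> has eigenvalues \<open>\<sigma>\<^sub>i\<^sup>2 + \<sigma>\<^sub>j\<^sup>2\<close>, with \<open>\<sigma>\<close> the singular values of
  \<open>X\<close>. All of them except possibly \<open>2 \<sigma>\<^sub>1\<^sup>2\<close> are at most \<open>\<parallel>X\<parallel>\<^sup>2 = 1\<close>, so the part is bounded by \<open>\<parallel>Y\<parallel>\<^sup>2\<close> on the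
  orthogonal complement of one matrix \<open>Y\<^sub>0\<close> (\<open>product_norms_codimension_one\<close>).

  Because of the pairing, losing the direction \<open>Y\<^sub>0\<close> costs nothing: the span of the first four
  eigenmatrices still contains orthonormal \<open>F\<^sub>0, F\<^sub>1, F\<^sub>2\<close> orthogonal to \<open>Y\<^sub>0\<close> with \<open>F\<^sub>0\<close> in the
  eigenspace of \<open>\<lambda>\<^sub>1 = \<lambda>\<^sub>2\<close>, and on all unit matrices in the span the form is at least \<open>\<lambda>\<^sub>4 = \<lambda>\<^sub>3\<close>. Hence
  \<open>2 \<lambda>\<^sub>1 + 2 \<lambda>\<^sub>3 \<le> 2 \<langle>T\<^sub>X F\<^sub>0, F\<^sub>0\<rangle> + \<langle>T\<^sub>X F\<^sub>1, F\<^sub>1\<rangle> + \<langle>T\<^sub>X F\<^sub>2, F\<^sub>2\<rangle> \<le> 4 - 2 (2 q\<^sub>0 + q\<^sub>1 + q\<^sub>2)\<close>, where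
  \<open>q\<^sub>i = Re \<langle>X F\<^sub>i X\<^sup>*, F\<^sub>i\<rangle>\<close>.

  Third, \<open>- (2 q\<^sub>0 + q\<^sub>1 + q\<^sub>2) \<le> \<surd>10 / 2\<close>. The form \<open>Re \<langle>X Y X\<^sup>*, Y\<rangle>\<close> splits into
  \<open>\<langle>H Y H, Y\<rangle> + \<langle>G Y G, Y\<rangle>\<close> for \<open>X = H + \<i>G\<close> with Hermitian \<open>H\<close> and \<open>G\<close> (\<open>cartesian_decomposition\<close>).
  For Hermitian \<open>H\<close> with eigenvalues \<open>h\<^sub>k\<close>, the form \<open>- \<langle>H Y H, Y\<rangle>\<close> has eigenvalues \<open>- h\<^sub>k h\<^sub>l\<close>, and each
  value with \<open>k \<noteq> l\<close> occurs twice. So the weighted sum is at most \<open>3 m + m'\<close>, with \<open>m\<close> and \<open>m'\<close>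
  the two largest values counted without this repetition. In the critical case these share an index, say
  \<open>- h\<^sub>k (3 h\<^sub>l + h\<^sub>r)\<close>, which is at most \<open>\<surd>10 / 2 (h\<^sub>k\<^sup>2 + h\<^sub>l\<^sup>2 + h\<^sub>r\<^sup>2)\<close>
  (\<open>hermitian_compression_bound\<close>).
\<close>

section \<open>Diagonalization of Hermitian matrices\<close>

lemma homogeneous_system:
  fixes a :: "nat \<Rightarrow> nat \<Rightarrow> complex"
  assumes "m < k"
  obtains c where "\<exists>j<k. c j \<noteq> 0" "\<And>i. i < m \<Longrightarrow> (\<Sum>j<k. a i j * c j) = 0"
proof -
  define A where "A = mat k k (\<lambda>(i, j). if i < m then a i j else 0)"
  have A: "A \<in> carrier_mat k k" by (simp add: A_def)
  have "row A (k - 1) = 0\<^sub>v k" using assms by (intro eq_vecI) (auto simp: A_def)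
  then have "A = mat\<^sub>r k k (\<lambda>i. if i = k - 1 then 0\<^sub>v k else row A i)"
    using A by (intro eq_rowI) auto
  then have "det A = 0"
    using det_row_0[of "k - 1" k "row A"] A assms by auto
  then obtain v where v: "v \<in> carrier_vec k" "v \<noteq> 0\<^sub>v k" "A *\<^sub>v v = 0\<^sub>v k"
    using det_0_iff_vec_prod_zero[OF A] by blast
  show thesis
  proof
    show "\<exists>j<k. v $ j \<noteq> 0" using v by (metis carrier_vecD eq_vecI index_zero_vec(1,2))
    fix i assume i: "i < m"
    have "(A *\<^sub>v v) $ i = (\<Sum>j<k. a i j * v $ j)"
      using i assms v(1) by (auto simp: A_def scalar_prod_def lessThan_atLeast0)
    then show "(\<Sum>j<k. a i j * v $ j) = 0" using v(3) i assms by simp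
  qed
qed

lemma homogeneous_system_unit:
  fixes a :: "nat \<Rightarrow> nat \<Rightarrow> complex"
  assumes "m < k"
  obtains c where "(\<Sum>j<k. (cmod (c j))\<^sup>2) = 1" "\<And>i. i < m \<Longrightarrow> (\<Sum>j<k. a i j * c j) = 0"
proof -
  obtain c where c: "\<exists>j<k. c j \<noteq> 0" "\<And>i. i < m \<Longrightarrow> (\<Sum>j<k. a i j * c j) = 0"
    using homogeneous_system[OF assms, of a] by blast
  define s where "s = (\<Sum>j<k. (cmod (c j))\<^sup>2)"
  have "s > 0" unfolding s_def using c(1) by (auto intro!: sum_pos2)
  show thesis
  proof (rule that[of "\<lambda>j. c j / of_real (sqrt s)"])
    show "(\<Sum>j<k. (cmod (c j / of_real (sqrt s)))\<^sup>2) = 1"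
      using \<open>s > 0\<close> by (simp add: norm_divide power_divide flip: sum_divide_distrib s_def)
    fix i assume "i < m"
    show "(\<Sum>j<k. a i j * (c j / of_real (sqrt s))) = 0"
      using c(2)[OF \<open>i < m\<close>] by (simp flip: sum_divide_distrib)
  qed
qed

definition diag_of :: "nat \<Rightarrow> (nat \<Rightarrow> complex) \<Rightarrow> complex mat" where
  "diag_of n d = mat n n (\<lambda>(i, j). if i = j then d i else 0)"

lemma diag_of_carrier [simp]: "diag_of n d \<in> carrier_mat n n"
  by (simp add: diag_of_def)

lemma mult_index:
  assumes "A \<in> carrier_mat n n" "B \<in> carrier_mat n n" "i < n" "j < n"
  shows "(A * B) $$ (i, j) = (\<Sum>k<n. A $$ (i, k) * B $$ (k, j))"
  using assms by (auto simp: scalar_prod_def lessThan_atLeast0)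

text \<open>The point of this form is that the eigenvalues appear in the order of any prescribed
  factorization of the characteristic polynomial. A Schur decomposition \<open>A P = P B\<close> lists them on
  the diagonal of the triangular matrix \<open>B\<close>, so the spans of the first columns of \<open>P\<close> form a flag of
  invariant subspaces. A unit vector of the \<open>m\<close>-th member that is orthogonal to the previous member
  is, because \<open>A\<close> is Hermitian, an eigenvector for the \<open>m\<close>-th diagonal entry.\<close>

theorem hermitian_diagonalization:
  fixes A :: "complex mat"
  assumes A: "A \<in> carrier_mat n n" and herm: "mat_adjoint A = A"
    and cp: "char_poly A = (\<Prod>e\<leftarrow>es. [:- e, 1:])"
  obtains U where "U \<in> carrier_mat n n" "mat_adjoint U * U = 1\<^sub>m n" "U * mat_adjoint U = 1\<^sub>m n"
    "A * U = U * diag_of n (\<lambda>i. es ! i)"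
proof -
  obtain B P Q where schur: "schur_decomposition A es = (B, P, Q)"
    by (cases "schur_decomposition A es") auto
  have sim: "similar_mat_wit A B P Q" and ut: "upper_triangular B" and diag: "diag_mat B = es"
    using schur_decomposition[OF A cp schur] by auto
  note w = similar_mat_witD2[OF A sim]
  have car: "B \<in> carrier_mat n n" "P \<in> carrier_mat n n" "Q \<in> carrier_mat n n" using w by auto
  have AP: "A * P = P * B"
  proof -
    have "A * P = P * B * Q * P" using w by simp
    also have "\<dots> = P * B * (Q * P)" using car by (intro assoc_mult_mat) auto
    finally show ?thesis using w car by simp
  qed
  define p b where "p i j = P $$ (i, j)" and "b i j = B $$ (i, j)" for i j
  have b0: "b j l = 0" if "l < j" "j < n" for l j
    using ut that car unfolding upper_triangular_def b_def by auto
  have bm: "b m m = es ! m" if "m < n" for m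
    using that car unfolding b_def diag[symmetric] diag_mat_def by auto
  have APij: "(\<Sum>k<n. A $$ (i, k) * p k j) = (\<Sum>l<n. p i l * b l j)" if "i < n" "j < n" for i j
    using arg_cong[OF AP, of "\<lambda>M. M $$ (i, j)"] that
    unfolding mult_index[OF A car(2) that] mult_index[OF car(2,1) that] by (simp add: p_def b_def)
  have Aherm: "A $$ (j, i) = cnj (A $$ (i, j))" if "i < n" "j < n" for i j
    using adjoint_index[OF A, of j i] herm that by simp
  \<comment> \<open>A solution \<open>c\<close> gives the coordinates, in the columns of \<open>P\<close>, of the \<open>m\<close>-th new basis vector.\<close>
  define good where "good m c \<longleftrightarrow> (\<forall>j. j > m \<longrightarrow> c j = 0) \<and>
      (\<forall>i<m. (\<Sum>k<n. cnj (p k i) * (\<Sum>j<n. p k j * c j)) = 0) \<and>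
      (\<Sum>k<n. (\<Sum>j<n. p k j * c j) * cnj (\<Sum>j<n. p k j * c j)) = 1" for m c
  \<comment> \<open>Orthogonality to \<open>m\<close> columns gives \<open>m\<close> equations for \<open>m + 1\<close> coordinates.\<close>
  have "\<exists>c. good m c" if m: "m < n" for m
  proof -
    obtain c where c: "\<exists>j<Suc m. c j \<noteq> 0"
      "\<And>i. i < m \<Longrightarrow> (\<Sum>j<Suc m. (\<Sum>k<n. cnj (p k i) * p k j) * c j) = 0"
      using homogeneous_system[of m "Suc m" "\<lambda>i j. \<Sum>k<n. cnj (p k i) * p k j"] by blast
    define d where "d j = (if j < Suc m then c j else 0)" for j
    define x where "x k = (\<Sum>j<n. p k j * d j)" for k
    have xort: "(\<Sum>k<n. cnj (p k i) * x k) = 0" if "i < m" for i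
    proof -
      have "(\<Sum>k<n. cnj (p k i) * x k) = (\<Sum>k<n. \<Sum>j<n. cnj (p k i) * p k j * d j)"
        by (simp add: x_def sum_distrib_left mult.assoc)
      also have "\<dots> = (\<Sum>j<n. (\<Sum>k<n. cnj (p k i) * p k j) * d j)"
        by (subst sum.swap) (simp add: sum_distrib_right)
      also have "\<dots> = (\<Sum>j<Suc m. (\<Sum>k<n. cnj (p k i) * p k j) * d j)"
        using m by (intro sum.mono_neutral_right) (auto simp: d_def)
      also have "\<dots> = 0" using c(2)[OF that] by (simp add: d_def)
      finally show ?thesis .
    qed
    define s where "s = (\<Sum>k<n. (cmod (x k))\<^sup>2)"
    have "s \<noteq> 0"
    proof
      assume "s = 0"
      then have x0: "x k = 0" if "k < n" for k
        using that unfolding s_def by (subst (asm) sum_nonneg_eq_0_iff) auto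
      let ?d = "vec n d"
      have "P *\<^sub>v ?d = 0\<^sub>v n"
        using x0 car by (intro eq_vecI) (auto simp: x_def p_def scalar_prod_def lessThan_atLeast0)
      then have "Q *\<^sub>v (P *\<^sub>v ?d) = 0\<^sub>v n" using car by auto
      moreover have "Q *\<^sub>v (P *\<^sub>v ?d) = ?d"
        using car w by (subst assoc_mult_mat_vec[symmetric, of _ n n _ n]) auto
      ultimately have d0: "d j = 0" if "j < n" for j using that by (metis index_vec index_zero_vec(1))
      obtain j where "j < Suc m" "c j \<noteq> 0" using c(1) by blast
      then show False using d0[of j] m by (simp add: d_def)
    qed
    moreover have "s \<ge> 0" by (simp add: s_def sum_nonneg)
    ultimately have s: "s > 0" by simp
    define r where "r = complex_of_real (sqrt s)"
    have r: "r \<noteq> 0" "cnj r = r" "r * r = of_real s"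
      using s by (auto simp: r_def simp flip: of_real_mult)
    have xr: "(\<Sum>j<n. p k j * (d j / r)) = x k / r" for k
      by (simp add: x_def sum_divide_distrib)
    have "(\<Sum>k<n. x k * cnj (x k)) = of_real s"
      unfolding s_def by (simp add: complex_norm_square[symmetric])
    then have "(\<Sum>k<n. (x k / r) * cnj (x k / r)) = 1"
      using s r by (simp add: flip: sum_divide_distrib)
    moreover have "(\<Sum>k<n. cnj (p k i) * (x k / r)) = 0" if "i < m" for i
      using xort[OF that] by (simp flip: sum_divide_distrib)
    ultimately show ?thesis unfolding xr[symmetric] good_def
      by (intro exI[of _ "\<lambda>j. d j / r"]) (auto simp: d_def)
  qed
  then have "\<forall>m\<in>{..<n}. \<exists>c. good m c" by blast
  then obtain c where c: "good m (c m)" if "m < n" for m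
    using bchoice[of "{..<n}" good] by blast
  have c0: "c m j = 0" if "m < n" "j > m" for m j
    using c[OF that(1)] that(2) unfolding good_def by blast
  have cort: "(\<Sum>k<n. cnj (p k i) * (\<Sum>j<n. p k j * c m j)) = 0" if "m < n" "i < m" for m i
    using c[OF that(1)] that(2) unfolding good_def by blast
  have cnorm: "(\<Sum>k<n. (\<Sum>j<n. p k j * c m j) * cnj (\<Sum>j<n. p k j * c m j)) = 1" if "m < n" for m
    using c[OF that] unfolding good_def by blast
  define q where "q m k = (\<Sum>j<n. p k j * c m j)" for m k
  have pair: "(\<Sum>k<n. f k * cnj (\<Sum>j<n. p k j * d j)) = (\<Sum>j<n. cnj (d j) * (\<Sum>k<n. cnj (p k j) * f k))"
    for f d
  proof -
    have "(\<Sum>k<n. f k * cnj (\<Sum>j<n. p k j * d j)) = (\<Sum>k<n. \<Sum>j<n. cnj (d j) * (cnj (p k j) * f k))"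
      by (simp add: sum_distrib_left mult_ac)
    also have "\<dots> = (\<Sum>j<n. cnj (d j) * (\<Sum>k<n. cnj (p k j) * f k))"
      by (subst sum.swap) (simp add: sum_distrib_left)
    finally show ?thesis .
  qed
  have qort: "(\<Sum>k<n. q m k * cnj (q i k)) = 0" if "i < m" "m < n" for i m
  proof -
    have "(\<Sum>k<n. q m k * cnj (q i k)) = (\<Sum>j<n. cnj (c i j) * (\<Sum>k<n. cnj (p k j) * q m k))"
      unfolding q_def[of i] by (rule pair)
    also have "\<dots> = 0"
    proof (rule sum.neutral, intro ballI)
      fix j assume "j \<in> {..<n}"
      show "cnj (c i j) * (\<Sum>k<n. cnj (p k j) * q m k) = 0"
        using c0[of i j] cort[of m j] that by (cases "j < m") (auto simp: q_def)
    qed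
    finally show ?thesis .
  qed
  have qON: "(\<Sum>k<n. cnj (q i k) * q m k) = (if i = m then 1 else 0)" if "i < n" "m < n" for i m
  proof (cases i m rule: linorder_cases)
    case less then show ?thesis using qort[OF less that(2)] by (simp add: mult.commute)
  next
    case equal then show ?thesis using cnorm[OF that(2)] by (simp add: q_def mult.commute)
  next
    case greater
    then have "cnj (\<Sum>k<n. q i k * cnj (q m k)) = 0" using qort[OF greater that(1)] by simp
    then show ?thesis using greater by simp
  qed
  have qeig: "(\<Sum>l<n. A $$ (k, l) * q m l) = es ! m * q m k" if k: "k < n" and m: "m < n" for k m
  proof -
    define d where "d j = (\<Sum>l<n. b j l * c m l) - es ! m * c m j" for j
    define s where "s k = (\<Sum>l<n. A $$ (k, l) * q m l) - es ! m * q m k" for k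
    have s_d: "s k = (\<Sum>j<n. p k j * d j)" if k: "k < n" for k
    proof -
      have "(\<Sum>l<n. A $$ (k, l) * q m l) = (\<Sum>j<n. (\<Sum>l<n. A $$ (k, l) * p l j) * c m j)"
        unfolding q_def sum_distrib_left sum_distrib_right by (subst sum.swap) (simp add: mult_ac)
      also have "\<dots> = (\<Sum>j<n. (\<Sum>l<n. p k l * b l j) * c m j)"
        using APij k by (intro sum.cong) auto
      also have "\<dots> = (\<Sum>j<n. p k j * (\<Sum>l<n. b j l * c m l))"
        unfolding sum_distrib_left sum_distrib_right by (subst sum.swap) (simp add: mult_ac)
      finally show ?thesis
        by (simp add: s_def d_def q_def right_diff_distrib sum_subtractf sum_distrib_left mult_ac)
    qed
    \<comment> \<open>The error vector \<open>s\<close> lies in the span of the first \<open>m\<close> columns, because the diagonal entry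
      of \<open>B\<close> cancels the leading coordinate; it is also orthogonal to those columns, hence zero.\<close>
    have d0: "d j = 0" if "j \<ge> m" "j < n" for j
    proof -
      have "(\<Sum>l<n. b j l * c m l) = (\<Sum>l<n. if l = m then b j m * c m m else 0)"
      proof (intro sum.cong refl)
        fix l assume "l \<in> {..<n}"
        then show "b j l * c m l = (if l = m then b j m * c m m else 0)"
          using b0[of l j] c0[OF m, of l] that by (cases l m rule: linorder_cases) auto
      qed
      also have "\<dots> = b j m * c m m" using m by simp
      also have "\<dots> = es ! m * c m j"
        using that b0[of m j] bm[OF m] c0[OF m, of j] by (cases "j = m") auto
      finally show ?thesis by (simp add: d_def)
    qed
    have ps: "(\<Sum>k<n. cnj (p k i) * s k) = 0" if i: "i < m" for i
    proof -
      have i': "i < n" using i m by simp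
      have "(\<Sum>k<n. cnj (p k i) * (\<Sum>l<n. A $$ (k, l) * q m l)) =
          (\<Sum>l<n. (\<Sum>k<n. cnj (p k i) * A $$ (k, l)) * q m l)"
        unfolding sum_distrib_left sum_distrib_right by (subst sum.swap) (simp add: mult_ac)
      also have "\<dots> = (\<Sum>l<n. cnj (\<Sum>k<n. A $$ (l, k) * p k i) * q m l)"
      proof (intro sum.cong refl arg_cong2[where f = "(*)"])
        fix l assume l: "l \<in> {..<n}"
        have "cnj (p k i) * A $$ (k, l) = cnj (A $$ (l, k) * p k i)" if "k < n" for k
          unfolding Aherm[of l k, OF l[simplified] that] by simp
        then show "(\<Sum>k<n. cnj (p k i) * A $$ (k, l)) = cnj (\<Sum>k<n. A $$ (l, k) * p k i)"
          unfolding cnj_sum by (intro sum.cong) auto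
      qed
      also have "\<dots> = (\<Sum>l<n. q m l * cnj (\<Sum>j<n. p l j * b j i))"
        using APij i' by (intro sum.cong) (auto simp: mult_ac)
      also have "\<dots> = (\<Sum>j<n. cnj (b j i) * (\<Sum>k<n. cnj (p k j) * q m k))"
        by (rule pair)
      also have "\<dots> = 0"
      proof (rule sum.neutral, intro ballI)
        fix j assume "j \<in> {..<n}"
        then show "cnj (b j i) * (\<Sum>k<n. cnj (p k j) * q m k) = 0"
          using b0[of i j] cort[of m j] i m by (cases "j \<le> i") (auto simp: q_def)
      qed
      finally have "(\<Sum>k<n. cnj (p k i) * (\<Sum>l<n. A $$ (k, l) * q m l)) = 0" .
      moreover have "(\<Sum>k<n. cnj (p k i) * (es ! m * q m k)) = es ! m * (\<Sum>k<n. cnj (p k i) * q m k)"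
        by (simp add: sum_distrib_left mult_ac)
      ultimately show ?thesis
        using cort[OF m i] by (simp add: s_def right_diff_distrib sum_subtractf q_def)
    qed
    have "(\<Sum>k<n. s k * cnj (s k)) = (\<Sum>k<n. s k * cnj (\<Sum>j<n. p k j * d j))"
      using s_d by (intro sum.cong) auto
    also have "\<dots> = (\<Sum>j<n. cnj (d j) * (\<Sum>k<n. cnj (p k j) * s k))"
      by (rule pair)
    also have "\<dots> = 0"
    proof (rule sum.neutral, intro ballI)
      fix j assume "j \<in> {..<n}"
      then show "cnj (d j) * (\<Sum>k<n. cnj (p k j) * s k) = 0"
        using d0[of j] ps[of j] by (cases "j < m") auto
    qed
    finally have "complex_of_real (\<Sum>k<n. (cmod (s k))\<^sup>2) = 0"
      by (simp add: complex_norm_square[symmetric])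
    then have "(\<Sum>k<n. (cmod (s k))\<^sup>2) = 0" by (simp only: of_real_eq_0_iff)
    then have "s k = 0" using k by (subst (asm) sum_nonneg_eq_0_iff) auto
    then show ?thesis by (simp add: s_def)
  qed
  define U where "U = mat n n (\<lambda>(k, m). q m k)"
  have U: "U \<in> carrier_mat n n" by (simp add: U_def)
  have Uij: "U $$ (k, m) = q m k" if "k < n" "m < n" for k m using that by (simp add: U_def)
  note aU = adjoint_carrier[OF U]
  have UU: "mat_adjoint U * U = 1\<^sub>m n"
  proof (rule eq_matI)
    fix i j assume "i < dim_row (1\<^sub>m n :: complex mat)" "j < dim_col (1\<^sub>m n :: complex mat)"
    then have ij: "i < n" "j < n" by auto
    show "(mat_adjoint U * U) $$ (i, j) = 1\<^sub>m n $$ (i, j)"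
      using ij qON[OF ij] unfolding mult_index[OF aU U ij] by (simp add: adjoint_index[OF U] Uij)
  qed (use aU U in auto)
  show thesis
  proof
    show "U * mat_adjoint U = 1\<^sub>m n" by (rule mat_mult_left_right_inverse[OF aU U UU])
    show "A * U = U * diag_of n (\<lambda>i. es ! i)"
    proof (rule eq_matI)
      fix i j assume "i < dim_row (U * diag_of n (\<lambda>i. es ! i))" "j < dim_col (U * diag_of n (\<lambda>i. es ! i))"
      then have ij: "i < n" "j < n" using U by (auto simp: diag_of_def)
      have "(\<Sum>k<n. q k i * (if k = j then es ! k else 0)) = (\<Sum>k<n. if k = j then q j i * es ! j else 0)"
        by (intro sum.cong) auto
      then show "(A * U) $$ (i, j) = (U * diag_of n (\<lambda>i. es ! i)) $$ (i, j)"
        using ij qeig[OF ij]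
        unfolding mult_index[OF A U ij] mult_index[OF U diag_of_carrier ij]
        by (simp add: diag_of_def Uij)
    qed (use A U in \<open>auto simp: diag_of_def\<close>)
  qed (fact U UU)+
qed

section \<open>The Frobenius inner product\<close>

lemma adjoint_mult:
  fixes A B :: "complex mat"
  assumes A: "A \<in> carrier_mat n n" and B: "B \<in> carrier_mat n n"
  shows "mat_adjoint (A * B) = mat_adjoint B * mat_adjoint A"
proof (rule eq_matI)
  note car = adjoint_carrier[OF A] adjoint_carrier[OF B] mult_carrier_mat[OF A B]
  fix i j assume "i < dim_row (mat_adjoint B * mat_adjoint A)" "j < dim_col (mat_adjoint B * mat_adjoint A)"
  then have ij: "i < n" "j < n" using car by auto
  show "mat_adjoint (A * B) $$ (i, j) = (mat_adjoint B * mat_adjoint A) $$ (i, j)"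
    unfolding mult_index[OF car(2,1) ij] adjoint_index[OF car(3) ij] mult_index[OF A B ij(2,1)]
    using ij by (simp add: adjoint_index[OF A] adjoint_index[OF B] mult.commute)
qed (use adjoint_carrier[OF A] adjoint_carrier[OF B] adjoint_carrier[OF mult_carrier_mat[OF A B]] in auto)

lemma adjoint_adjoint:
  fixes A :: "complex mat"
  assumes A: "A \<in> carrier_mat n n"
  shows "mat_adjoint (mat_adjoint A) = A"
proof (rule eq_matI)
  fix i j assume "i < dim_row A" "j < dim_col A"
  then show "mat_adjoint (mat_adjoint A) $$ (i, j) = A $$ (i, j)"
    using A by (simp add: adjoint_index[OF adjoint_carrier[OF A]] adjoint_index[OF A])
qed (use A adjoint_carrier[OF adjoint_carrier[OF A]] in auto)

lemma adjoint_minus: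
  fixes A B :: "complex mat"
  assumes A: "A \<in> carrier_mat n n" and B: "B \<in> carrier_mat n n"
  shows "mat_adjoint (A - B) = mat_adjoint A - mat_adjoint B"
proof (rule eq_matI)
  have car: "A - B \<in> carrier_mat n n" using A B by auto
  fix i j assume "i < dim_row (mat_adjoint A - mat_adjoint B)" "j < dim_col (mat_adjoint A - mat_adjoint B)"
  then have ij: "i < n" "j < n" using adjoint_carrier[OF B] by auto
  then show "mat_adjoint (A - B) $$ (i, j) = (mat_adjoint A - mat_adjoint B) $$ (i, j)"
    using A B adjoint_carrier[OF B] by (simp add: adjoint_index[OF A] adjoint_index[OF B] adjoint_index[OF car])
qed (use A B adjoint_carrier[OF B] adjoint_carrier[OF minus_carrier_mat[OF B], of A] in auto)

lemma adjoint_commutator: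
  assumes A: "A \<in> carrier_mat n n" and B: "B \<in> carrier_mat n n"
  shows "mat_adjoint (commutator A B) = commutator (mat_adjoint B) (mat_adjoint A)"
  using A B unfolding commutator_def
  by (subst adjoint_minus[of _ n]) (auto simp: adjoint_mult)

lemma inner_mat_cnj: "cnj (inner_mat n Y Z) = inner_mat n Z Y"
  by (simp add: inner_mat_def mult.commute)

lemma inner_mat_add:
  assumes "Y \<in> carrier_mat n n" "Z \<in> carrier_mat n n"
  shows "inner_mat n (Y + Z) W = inner_mat n Y W + inner_mat n Z W"
  using assms by (simp add: inner_mat_def distrib_right sum.distrib)

lemma inner_mat_add_right:
  assumes "Y \<in> carrier_mat n n" "Z \<in> carrier_mat n n"
  shows "inner_mat n W (Y + Z) = inner_mat n W Y + inner_mat n W Z"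
  using assms by (simp add: inner_mat_def distrib_left sum.distrib)

lemma inner_mat_diff:
  assumes "Y \<in> carrier_mat n n" "Z \<in> carrier_mat n n"
  shows "inner_mat n (Y - Z) W = inner_mat n Y W - inner_mat n Z W"
  using assms by (simp add: inner_mat_def left_diff_distrib sum_subtractf)

lemma inner_mat_diff_right:
  assumes "Y \<in> carrier_mat n n" "Z \<in> carrier_mat n n"
  shows "inner_mat n W (Y - Z) = inner_mat n W Y - inner_mat n W Z"
  using assms by (simp add: inner_mat_def right_diff_distrib sum_subtractf)

lemma inner_mat_smult:
  assumes "Y \<in> carrier_mat n n"
  shows "inner_mat n (c \<cdot>\<^sub>m Y) W = c * inner_mat n Y W"
  using assms by (simp add: inner_mat_def sum_distrib_left mult.assoc)

lemma inner_mat_smult_right: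
  assumes "Y \<in> carrier_mat n n"
  shows "inner_mat n W (c \<cdot>\<^sub>m Y) = cnj c * inner_mat n W Y"
  using assms by (simp add: inner_mat_def sum_distrib_left mult_ac)

lemma inner_mat_mult_left:
  assumes A: "A \<in> carrier_mat n n" and Y: "Y \<in> carrier_mat n n" and Z: "Z \<in> carrier_mat n n"
  shows "inner_mat n (A * Y) Z = inner_mat n Y (mat_adjoint A * Z)"
proof -
  have "inner_mat n (A * Y) Z = (\<Sum>i<n. \<Sum>j<n. \<Sum>k<n. A $$ (i, k) * Y $$ (k, j) * cnj (Z $$ (i, j)))"
    by (simp add: inner_mat_def mult_index[OF A Y] sum_distrib_right del: index_mult_mat)
  also have "\<dots> = (\<Sum>i<n. \<Sum>k<n. \<Sum>j<n. A $$ (i, k) * Y $$ (k, j) * cnj (Z $$ (i, j)))"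
    by (intro sum.cong refl sum.swap)
  also have "\<dots> = (\<Sum>k<n. \<Sum>i<n. \<Sum>j<n. A $$ (i, k) * Y $$ (k, j) * cnj (Z $$ (i, j)))"
    by (rule sum.swap)
  also have "\<dots> = (\<Sum>k<n. \<Sum>j<n. \<Sum>i<n. A $$ (i, k) * Y $$ (k, j) * cnj (Z $$ (i, j)))"
    by (intro sum.cong refl sum.swap)
  also have "\<dots> = inner_mat n Y (mat_adjoint A * Z)"
    by (simp add: inner_mat_def mult_index[OF adjoint_carrier[OF A] Z] adjoint_index[OF A]
        sum_distrib_left mult_ac del: index_mult_mat)
  finally show ?thesis .
qed

lemma inner_mat_adjoint_adjoint:
  assumes Y: "Y \<in> carrier_mat n n" and Z: "Z \<in> carrier_mat n n"
  shows "inner_mat n (mat_adjoint Y) (mat_adjoint Z) = inner_mat n Z Y"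
  unfolding inner_mat_def
  by (subst sum.swap) (simp add: adjoint_index[OF Y] adjoint_index[OF Z] mult.commute)

lemma inner_mat_mult_right:
  assumes A: "A \<in> carrier_mat n n" and Y: "Y \<in> carrier_mat n n" and Z: "Z \<in> carrier_mat n n"
  shows "inner_mat n (Y * A) Z = inner_mat n Y (Z * mat_adjoint A)"
proof -
  note car = adjoint_carrier[OF A] adjoint_carrier[OF Y] adjoint_carrier[OF Z]
  have "inner_mat n (Y * A) Z = inner_mat n (mat_adjoint Z) (mat_adjoint A * mat_adjoint Y)"
    using inner_mat_adjoint_adjoint[OF Z mult_carrier_mat[OF Y A]] by (simp add: adjoint_mult[OF Y A])
  also have "\<dots> = inner_mat n (A * mat_adjoint Z) (mat_adjoint Y)"
    using inner_mat_mult_left[OF A car(3) car(2)] by simp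
  also have "\<dots> = inner_mat n Y (mat_adjoint (A * mat_adjoint Z))"
    using inner_mat_adjoint_adjoint[OF adjoint_carrier[OF mult_carrier_mat[OF A car(3)]] Y]
    unfolding adjoint_adjoint[OF mult_carrier_mat[OF A car(3)]] .
  finally show ?thesis using A Z car by (simp add: adjoint_mult adjoint_adjoint)
qed

lemma frobenius_norm_sq:
  assumes "X \<in> carrier_mat n n"
  shows "inner_mat n X X = of_real ((frobenius_norm X)\<^sup>2)"
  unfolding frobenius_norm_eq[OF assms] inner_mat_self by (simp add: sum_nonneg)

lemma norm_entry_le_inner_mat_self:
  assumes "k < n" "l < n"
  shows "(cmod (Y $$ (k, l)))\<^sup>2 \<le> Re (inner_mat n Y Y)"
proof -
  have "(cmod (Y $$ (k, l)))\<^sup>2 \<le> (\<Sum>j<n. (cmod (Y $$ (k, j)))\<^sup>2)"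
    using assms by (intro member_le_sum) auto
  also have "\<dots> \<le> (\<Sum>i<n. \<Sum>j<n. (cmod (Y $$ (i, j)))\<^sup>2)"
    using assms by (intro member_le_sum[where f = "\<lambda>i. \<Sum>j<n. (cmod (Y $$ (i, j)))\<^sup>2"]) (auto intro: sum_nonneg)
  finally show ?thesis unfolding inner_mat_self by simp
qed

lemma inner_mat_sum:
  fixes m :: nat
  assumes "\<And>i. i < m \<Longrightarrow> F i \<in> carrier_mat n n"
  shows "inner_mat n (mat n n (\<lambda>p. \<Sum>i<m. c i * F i $$ p)) W = (\<Sum>i<m. c i * inner_mat n (F i) W)"
proof (induction m)
  case 0 show ?case by (simp add: inner_mat_def)
next
  case (Suc m)
  have "inner_mat n (mat n n (\<lambda>p. \<Sum>i<Suc m. c i * F i $$ p)) W =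
     inner_mat n (mat n n (\<lambda>p. \<Sum>i<m. c i * F i $$ p)) W + c m * inner_mat n (F m) W"
    by (simp add: inner_mat_def distrib_right sum.distrib sum_distrib_left mult.assoc)
  then show ?case using Suc by simp
qed

text \<open>Bessel's inequality for a matrix unit. The projection \<open>g\<close> of the matrix unit onto the span of
  the \<open>F i\<close> satisfies \<open>\<parallel>g\<parallel>\<^sup>2 = g\<^sub>k\<^sub>l = s\<close>, where \<open>s\<close> is the sum to be bounded, and no entry exceeds the
  norm, so \<open>s\<^sup>2 \<le> s\<close>.\<close>

lemma bessel_entry:
  fixes m :: nat
  assumes F: "\<And>i. i < m \<Longrightarrow> F i \<in> carrier_mat n n"
    and on: "\<And>i j. i < m \<Longrightarrow> j < m \<Longrightarrow> inner_mat n (F i) (F j) = (if i = j then 1 else 0)"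
    and kl: "k < n" "l < n"
  shows "(\<Sum>i<m. (cmod (F i $$ (k, l)))\<^sup>2) \<le> 1"
proof -
  define s where "s = (\<Sum>i<m. (cmod (F i $$ (k, l)))\<^sup>2)"
  define g where "g = mat n n (\<lambda>p. \<Sum>i<m. cnj (F i $$ (k, l)) * F i $$ p)"
  have g: "g $$ (k, l) = of_real s"
    unfolding s_def of_real_sum complex_norm_square using kl by (simp add: g_def mult.commute)
  have Fg: "inner_mat n (F i) g = F i $$ (k, l)" if "i < m" for i
  proof -
    have "inner_mat n g (F i) = (\<Sum>j<m. cnj (F j $$ (k, l)) * inner_mat n (F j) (F i))"
      unfolding g_def by (rule inner_mat_sum[OF F])
    also have "\<dots> = (\<Sum>j<m. if j = i then cnj (F i $$ (k, l)) else 0)"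
      using on that by (intro sum.cong) auto
    finally have "inner_mat n g (F i) = cnj (F i $$ (k, l))" using that by simp
    then show ?thesis by (metis inner_mat_cnj complex_cnj_cnj)
  qed
  have "inner_mat n g g = (\<Sum>i<m. cnj (F i $$ (k, l)) * inner_mat n (F i) g)"
    unfolding g_def by (rule inner_mat_sum[OF F])
  also have "\<dots> = of_real s"
    unfolding s_def of_real_sum complex_norm_square using Fg by (simp add: mult.commute)
  finally have "s\<^sup>2 \<le> s"
    using norm_entry_le_inner_mat_self[OF kl, of g] g by (simp add: norm_of_real)
  have "s \<le> 1"
  proof (rule ccontr)
    assume "\<not> s \<le> 1"
    then have "s * 1 < s * s" by (intro mult_strict_left_mono) auto
    with \<open>s\<^sup>2 \<le> s\<close> show False by (simp add: power2_eq_square)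
  qed
  then show ?thesis by (simp add: s_def)
qed

lemma inner_mat_conj:
  assumes U: "U \<in> carrier_mat n n" and V: "V \<in> carrier_mat n n"
    and UU: "U * mat_adjoint U = 1\<^sub>m n" and VV: "V * mat_adjoint V = 1\<^sub>m n"
    and Y: "Y \<in> carrier_mat n n" and Z: "Z \<in> carrier_mat n n"
  shows "inner_mat n (mat_adjoint U * Y * V) (mat_adjoint U * Z * V) = inner_mat n Y Z"
proof -
  note aU = adjoint_carrier[OF U] note aV = adjoint_carrier[OF V]
  have "inner_mat n (mat_adjoint U * Y * V) (mat_adjoint U * Z * V) =
      inner_mat n (mat_adjoint U * Y) (mat_adjoint U * Z * V * mat_adjoint V)"
    using U V aU Y Z by (intro inner_mat_mult_right) auto
  also have "mat_adjoint U * Z * V * mat_adjoint V = mat_adjoint U * Z * (V * mat_adjoint V)"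
    using aU V aV Z by (intro assoc_mult_mat) auto
  also have "\<dots> = mat_adjoint U * Z" using VV aU Z by simp
  also have "inner_mat n (mat_adjoint U * Y) (mat_adjoint U * Z) =
      inner_mat n Y (mat_adjoint (mat_adjoint U) * (mat_adjoint U * Z))"
    using aU Y Z by (intro inner_mat_mult_left) auto
  also have "mat_adjoint (mat_adjoint U) * (mat_adjoint U * Z) = U * mat_adjoint U * Z"
    unfolding adjoint_adjoint[OF U] using U aU Z by (intro assoc_mult_mat[symmetric]) auto
  also have "\<dots> = Z" using UU Z by simp
  finally show ?thesis .
qed

section \<open>An inequality for products of real numbers\<close>

text \<open>This is where \<open>\<surd>10\<close> comes from: \<open>\<bar>3t + r\<bar> \<le> \<surd>(3\<^sup>2 + 1\<^sup>2) \<surd>(t\<^sup>2 + r\<^sup>2)\<close> by the Cauchy-Schwarz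
  inequality, followed by the inequality of the arithmetic and geometric mean.\<close>

lemma three_to_one_product_bound:
  fixes s t r :: real
  shows "- (s * (3 * t + r)) \<le> sqrt 10 / 2 * (s\<^sup>2 + t\<^sup>2 + r\<^sup>2)"
proof -
  define c where "c = sqrt 10"
  have c: "c > 0" "c * c = 10" by (simp_all add: c_def)
  have "0 \<le> (c * s + (3 * t + r))\<^sup>2 + (t - 3 * r)\<^sup>2" by simp
  also have "\<dots> = c * c * s\<^sup>2 + 2 * c * (s * (3 * t + r)) + 10 * (t\<^sup>2 + r\<^sup>2)"
    by (simp add: power2_eq_square algebra_simps)
  also have "\<dots> = c * (c * s\<^sup>2 + 2 * (s * (3 * t + r)) + c * (t\<^sup>2 + r\<^sup>2))"
    unfolding c(2)[symmetric] by (simp add: algebra_simps)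
  finally have "0 \<le> c * s\<^sup>2 + 2 * (s * (3 * t + r)) + c * (t\<^sup>2 + r\<^sup>2)"
    using c(1) by (simp add: zero_le_mult_iff)
  then show ?thesis by (simp add: c_def[symmetric] field_simps)
qed

text \<open>The two index pairs either share exactly one index, which is the extremal case of
  \<open>three_to_one_product_bound\<close>, or the products can be estimated separately with the smaller
  constant \<open>3/2\<close>.\<close>

lemma two_products_bound:
  fixes h :: "nat \<Rightarrow> real"
  assumes pq: "p < n" "q < n" "p \<noteq> q" and kl: "k < n" "l < n"
    and other: "(k, l) \<noteq> (p, q)" "(k, l) \<noteq> (q, p)"
  shows "- 3 * (h p * h q) - h k * h l \<le> sqrt 10 / 2 * (\<Sum>i<n. (h i)\<^sup>2)"
proof -
  have sub: "(\<Sum>i\<in>S. (h i)\<^sup>2) \<le> (\<Sum>i<n. (h i)\<^sup>2)" if "S \<subseteq> {..<n}" for S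
    using that by (intro sum_mono2) auto
  have share: "- (h s * (3 * h t + h r)) \<le> sqrt 10 / 2 * (\<Sum>i<n. (h i)\<^sup>2)"
    if "s < n" "t < n" "r < n" "s \<noteq> t" "s \<noteq> r" "t \<noteq> r" for s t r
  proof -
    have "(h s)\<^sup>2 + (h t)\<^sup>2 + (h r)\<^sup>2 = (\<Sum>i\<in>{s, t, r}. (h i)\<^sup>2)" using that by simp
    also have "\<dots> \<le> (\<Sum>i<n. (h i)\<^sup>2)" using that by (intro sub) auto
    finally show ?thesis
      using three_to_one_product_bound[of "h s" "h t" "h r"]
      by (smt (verit) mult_left_mono real_sqrt_ge_zero divide_nonneg_nonneg)
  qed
  have s10: "sqrt 10 \<ge> 3" by (rule real_le_rsqrt) simp
  have am: "- 2 * (x * y) \<le> x\<^sup>2 + y\<^sup>2" for x y :: real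
    using zero_le_power2[of "x + y"] by (simp add: power2_eq_square algebra_simps)
  have big: "3 / 2 * S \<le> sqrt 10 / 2 * (\<Sum>i<n. (h i)\<^sup>2)" if "S \<le> (\<Sum>i<n. (h i)\<^sup>2)" for S
    using mult_mono[of "3 / 2" "sqrt 10 / 2" "\<Sum>i<n. (h i)\<^sup>2" "\<Sum>i<n. (h i)\<^sup>2"] s10 that
      mult_left_mono[OF that, of "3 / 2"] by (simp add: sum_nonneg)
  consider "k = l" | "k \<noteq> l" "k = p" | "k \<noteq> l" "k = q" | "k \<noteq> l" "l = p" | "k \<noteq> l" "l = q"
    | "k \<noteq> l" "k \<noteq> p" "k \<noteq> q" "l \<noteq> p" "l \<noteq> q" by blast
  then show ?thesis
  proof cases
    case 1
    have "(h p)\<^sup>2 + (h q)\<^sup>2 = (\<Sum>i\<in>{p, q}. (h i)\<^sup>2)" using pq by simp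
    also have "\<dots> \<le> (\<Sum>i<n. (h i)\<^sup>2)" using pq by (intro sub) auto
    finally show ?thesis using big[of "(h p)\<^sup>2 + (h q)\<^sup>2"] am[of "h p" "h q"] 1
      by (simp add: power2_eq_square[symmetric]) (smt (verit) zero_le_power2)
  next
    case 2 then show ?thesis using share[of p q l] pq kl other by (auto simp: algebra_simps)
  next
    case 3 then show ?thesis using share[of q p l] pq kl other by (auto simp: algebra_simps)
  next
    case 4 then show ?thesis using share[of p q k] pq kl other by (auto simp: algebra_simps)
  next
    case 5 then show ?thesis using share[of q p k] pq kl other by (auto simp: algebra_simps)
  next
    case 6
    have "(h p)\<^sup>2 + (h q)\<^sup>2 + (h k)\<^sup>2 + (h l)\<^sup>2 = (\<Sum>i\<in>{p, q, k, l}. (h i)\<^sup>2)" using pq 6 by simp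
    also have "\<dots> \<le> (\<Sum>i<n. (h i)\<^sup>2)" using pq kl by (intro sub) auto
    finally show ?thesis
      using big[of "(h p)\<^sup>2 + (h q)\<^sup>2 + (h k)\<^sup>2 + (h l)\<^sup>2"] am[of "h p" "h q"] am[of "h k" "h l"]
      by simp (smt (verit) zero_le_power2)
  qed
qed

text \<open>The negated products \<open>- h\<^sub>k h\<^sub>l\<close> come in equal pairs \<open>(k, l)\<close>, \<open>(l, k)\<close>. Let \<open>P\<close> carry the largest
  value and let \<open>Q\<close> carry the largest value outside the pair of \<open>P\<close>. The weight \<open>v\<close> of mass 1
  contributes at most the value at \<open>P\<close>; the weight \<open>w\<close> of mass 3 can put at most 2 on the pair of \<open>P\<close>,
  since it is bounded by 1, so it contributes at most twice the value at \<open>P\<close> plus the value at \<open>Q\<close>.\<close>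

lemma weighted_products_bound:
  fixes h :: "nat \<Rightarrow> real" and v w :: "nat \<times> nat \<Rightarrow> real"
  assumes n: "n \<ge> 2"
    and v: "\<And>r. r \<in> {..<n} \<times> {..<n} \<Longrightarrow> v r \<ge> 0" "(\<Sum>r\<in>{..<n} \<times> {..<n}. v r) = 1"
    and w: "\<And>r. r \<in> {..<n} \<times> {..<n} \<Longrightarrow> 0 \<le> w r \<and> w r \<le> 1" "(\<Sum>r\<in>{..<n} \<times> {..<n}. w r) = 3"
  shows "(\<Sum>r\<in>{..<n} \<times> {..<n}. - (h (fst r) * h (snd r)) * (v r + w r)) \<le> sqrt 10 / 2 * (\<Sum>i<n. (h i)\<^sup>2)"
proof -
  define I where "I = {..<n} \<times> {..<n}"
  define f where "f r = - (h (fst r) * h (snd r))" for r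
  have fin: "finite I" by (simp add: I_def)
  have "(0, 0) \<in> I" using n by (simp add: I_def)
  then have "Max (f ` I) \<in> f ` I" using fin by (intro Max_in) auto
  then obtain P where P: "P \<in> I" "f P = Max (f ` I)" by auto
  have Pmax: "f r \<le> f P" if "r \<in> I" for r using that fin P by simp
  define J where "J = {P, (snd P, fst P)}"
  have J: "J \<subseteq> I" using P by (auto simp: J_def I_def)
  have "I - J \<noteq> {}"
  proof (cases "fst P = snd P")
    case True
    have "\<exists>i<n. i \<noteq> fst P" using n by (metis less_numeral_extra(1) one_less_numeral_iff order_less_le_trans pos2 semiring_norm(76) zero_neq_one)
    then obtain i where "i < n" "i \<noteq> fst P" by blast
    then have "(i, i) \<in> I - J" by (auto simp: I_def J_def)
    then show ?thesis by blast
  next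
    case False
    then have "(fst P, fst P) \<in> I - J" using P by (cases P) (auto simp: I_def J_def)
    then show ?thesis by blast
  qed
  then have "Max (f ` (I - J)) \<in> f ` (I - J)" using fin by (intro Max_in) auto
  then obtain Q where Q: "Q \<in> I - J" "f Q = Max (f ` (I - J))" by auto
  have Qmax: "f r \<le> f Q" if "r \<in> I - J" for r using that fin Q by simp
  have fJ: "f r = f P" if "r \<in> J" for r using that by (auto simp: J_def f_def)
  have QP: "f Q \<le> f P" using Pmax Q by blast
  have "(\<Sum>r\<in>I. f r * v r) \<le> (\<Sum>r\<in>I. f P * v r)"
    using Pmax v(1) by (intro sum_mono mult_right_mono) (auto simp: I_def)
  also have "\<dots> = f P" using v(2) by (simp add: I_def flip: sum_distrib_left)
  finally have 1: "(\<Sum>r\<in>I. f r * v r) \<le> f P" .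
  define x where "x = (\<Sum>r\<in>J. w r)"
  have "x \<le> (\<Sum>r\<in>J. 1)" unfolding x_def using w(1) J by (intro sum_mono) (auto simp: I_def)
  also have "\<dots> \<le> 2" by (simp add: J_def card_insert_if)
  finally have x: "x \<le> 2" .
  have split: "(\<Sum>r\<in>I. g r) = (\<Sum>r\<in>I - J. g r) + (\<Sum>r\<in>J. g r)" for g :: "nat \<times> nat \<Rightarrow> real"
    using fin J by (simp add: sum.subset_diff)
  have w3: "(\<Sum>r\<in>I - J. w r) = 3 - x"
    using split[of w] w(2) by (simp add: I_def x_def)
  have "(\<Sum>r\<in>I. f r * w r) = (\<Sum>r\<in>I - J. f r * w r) + (\<Sum>r\<in>J. f P * w r)"
    unfolding split[of "\<lambda>r. f r * w r"] using fJ by simp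
  also have "(\<Sum>r\<in>I - J. f r * w r) \<le> (\<Sum>r\<in>I - J. f Q * w r)"
    using Qmax w(1) by (intro sum_mono mult_right_mono) (auto simp: I_def)
  also have "\<dots> + (\<Sum>r\<in>J. f P * w r) = f Q * (3 - x) + f P * x"
    by (simp add: x_def w3 flip: sum_distrib_left)
  also have "\<dots> \<le> 2 * f P + f Q"
    using mult_nonneg_nonneg[of "f P - f Q" "2 - x"] QP x by (simp add: algebra_simps)
  finally have 2: "(\<Sum>r\<in>I. f r * w r) \<le> 2 * f P + f Q" by simp
  have 3: "3 * f P + f Q \<le> sqrt 10 / 2 * (\<Sum>i<n. (h i)\<^sup>2)"
  proof (cases "fst P = snd P")
    case True
    then have "f P \<le> 0" by (simp add: f_def)
    then have "3 * f P + f Q \<le> 0" using QP by simp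
    also have "\<dots> \<le> sqrt 10 / 2 * (\<Sum>i<n. (h i)\<^sup>2)" by (intro mult_nonneg_nonneg sum_nonneg) auto
    finally show ?thesis .
  next
    case False
    have "(fst Q, snd Q) \<noteq> (fst P, snd P)" "(fst Q, snd Q) \<noteq> (snd P, fst P)"
      using Q(1) by (auto simp: J_def)
    then show ?thesis
      using two_products_bound[of "fst P" n "snd P" "fst Q" "snd Q" h] False P(1) Q(1)
      by (auto simp: f_def I_def)
  qed
  have "(\<Sum>r\<in>I. f r * (v r + w r)) \<le> 3 * f P + f Q"
    using 1 2 by (simp add: distrib_left sum.distrib)
  then show ?thesis using 3 by (simp add: f_def I_def)
qed

section \<open>Three orthonormal matrices and a Hermitian matrix\<close>

lemma diag_mult_index:
  assumes "Z \<in> carrier_mat n n" "i < n" "j < n"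
  shows "(diag_of n d * Z) $$ (i, j) = d i * Z $$ (i, j)"
proof -
  have "(\<Sum>k<n. (if i = k then d i else 0) * Z $$ (k, j)) = (\<Sum>k<n. if k = i then d i * Z $$ (i, j) else 0)"
    by (intro sum.cong) auto
  then show ?thesis unfolding mult_index[OF diag_of_carrier assms] using assms by (simp add: diag_of_def)
qed

lemma mult_diag_index:
  assumes "Z \<in> carrier_mat n n" "i < n" "j < n"
  shows "(Z * diag_of n d) $$ (i, j) = Z $$ (i, j) * d j"
proof -
  have "(\<Sum>k<n. Z $$ (i, k) * (if k = j then d k else 0)) = (\<Sum>k<n. if k = j then Z $$ (i, j) * d j else 0)"
    by (intro sum.cong) auto
  then show ?thesis
    unfolding mult_index[OF assms(1) diag_of_carrier assms(2,3)] using assms by (simp add: diag_of_def)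
qed

lemma adjoint_diag_of_real:
  "mat_adjoint (diag_of n (\<lambda>i. of_real (d i))) = diag_of n (\<lambda>i. of_real (d i))"
proof (rule eq_matI)
  fix i j assume "i < dim_row (diag_of n (\<lambda>i. of_real (d i)))" "j < dim_col (diag_of n (\<lambda>i. of_real (d i)))"
  then have "i < n" "j < n" by (auto simp: diag_of_def)
  then show "mat_adjoint (diag_of n (\<lambda>i. of_real (d i))) $$ (i, j) = diag_of n (\<lambda>i. of_real (d i)) $$ (i, j)"
    by (simp add: adjoint_index[OF diag_of_carrier]) (simp add: diag_of_def)
qed (auto simp: carrier_matD[OF adjoint_carrier[OF diag_of_carrier]] carrier_matD[OF diag_of_carrier])

lemma hermitian_diagonalization_real:
  fixes A :: "complex mat"
  assumes A: "A \<in> carrier_mat n n" and herm: "mat_adjoint A = A"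
  obtains U d where "U \<in> carrier_mat n n" "mat_adjoint U * U = 1\<^sub>m n" "U * mat_adjoint U = 1\<^sub>m n"
    "A * U = U * diag_of n (\<lambda>i. of_real (d i))" "mat_adjoint U * A = diag_of n (\<lambda>i. of_real (d i)) * mat_adjoint U"
proof -
  obtain es where es: "char_poly A = (\<Prod>e\<leftarrow>es. [:- e, 1:])"
    using char_poly_factorized[OF A] by blast
  obtain U where U: "U \<in> carrier_mat n n" "mat_adjoint U * U = 1\<^sub>m n" "U * mat_adjoint U = 1\<^sub>m n"
    and AU: "A * U = U * diag_of n (\<lambda>i. es ! i)"
    using hermitian_diagonalization[OF A herm es] by blast
  note aU = adjoint_carrier[OF U(1)]
  let ?D = "diag_of n (\<lambda>i. es ! i)"
  have UAU: "mat_adjoint U * (A * U) = ?D"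
    unfolding AU using assoc_mult_mat[OF aU U(1) diag_of_carrier, symmetric] U(2)
    by (simp add: left_mult_one_mat[OF diag_of_carrier])
  have "mat_adjoint (mat_adjoint U * (A * U)) = mat_adjoint (A * U) * U"
    using A U(1) aU by (subst adjoint_mult[of _ n]) (auto simp: adjoint_adjoint)
  also have "\<dots> = mat_adjoint U * A * U" using A U(1) by (simp add: adjoint_mult herm)
  also have "\<dots> = ?D" using A U(1) aU UAU by (simp add: assoc_mult_mat)
  finally have Dherm: "mat_adjoint ?D = ?D" unfolding UAU .
  have real: "es ! i = of_real (Re (es ! i))" if "i < n" for i
  proof -
    have "cnj (es ! i) = es ! i"
      using arg_cong[OF Dherm, of "\<lambda>M. M $$ (i, i)"] that
      by (simp add: adjoint_index[OF diag_of_carrier]) (simp add: diag_of_def)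
    then show ?thesis by (simp add: complex_eq_iff)
  qed
  have D: "?D = diag_of n (\<lambda>i. of_real (Re (es ! i)))"
    using real by (auto simp: diag_of_def intro!: eq_matI)
  show thesis
  proof (rule that[OF U])
    show AU': "A * U = U * diag_of n (\<lambda>i. of_real (Re (es ! i)))" using AU D by simp
    show "mat_adjoint U * A = diag_of n (\<lambda>i. of_real (Re (es ! i))) * mat_adjoint U"
      using arg_cong[OF AU', of mat_adjoint] adjoint_mult[OF A U(1)] adjoint_mult[OF U(1) diag_of_carrier]
      by (simp add: herm adjoint_diag_of_real)
  qed
qed

text \<open>In an eigenbasis of \<open>H\<close> the form \<open>\<langle>H Y H, Y\<rangle>\<close> becomes \<open>\<Sum> h\<^sub>k h\<^sub>l \<bar>y\<^sub>k\<^sub>l\<bar>\<^sup>2\<close>, which reduces the claim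
  to \<open>weighted_products_bound\<close>. Its weights are the squared entries of the transformed \<open>F 0\<close>, of total
  mass 1, and the sums of the squared entries of all three matrices, of total mass 3 and bounded
  by 1 because of \<open>bessel_entry\<close>.\<close>

lemma hermitian_compression_bound:
  assumes n: "n \<ge> 2" and H: "H \<in> carrier_mat n n" and herm: "mat_adjoint H = H"
    and F: "\<And>i::nat. i < 3 \<Longrightarrow> F i \<in> carrier_mat n n"
    and on: "\<And>i j. i < 3 \<Longrightarrow> j < 3 \<Longrightarrow> inner_mat n (F i) (F j) = (if i = j then 1 else 0)"
  shows "- (Re (inner_mat n (H * F 0 * H) (F 0)) + (\<Sum>i<3. Re (inner_mat n (H * F i * H) (F i))))
    \<le> sqrt 10 / 2 * Re (inner_mat n H H)"
proof -
  obtain U h where U: "U \<in> carrier_mat n n" "mat_adjoint U * U = 1\<^sub>m n" "U * mat_adjoint U = 1\<^sub>m n"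
    and HU: "H * U = U * diag_of n (\<lambda>i. of_real (h i))"
    and UH: "mat_adjoint U * H = diag_of n (\<lambda>i. of_real (h i)) * mat_adjoint U"
    using hermitian_diagonalization_real[OF H herm] by blast
  note aU = adjoint_carrier[OF U(1)]
  let ?D = "diag_of n (\<lambda>i. of_real (h i))"
  define Z where "Z i = mat_adjoint U * F i * U" for i
  have Z: "Z i \<in> carrier_mat n n" if "i < 3" for i using F[OF that] U aU by (auto simp: Z_def)
  have Zon: "inner_mat n (Z i) (Z j) = (if i = j then 1 else 0)" if "i < 3" "j < 3" for i j
    unfolding Z_def using inner_mat_conj[OF U(1) U(1) U(3) U(3) F[OF that(1)] F[OF that(2)]] on[OF that] by simp
  have form: "Re (inner_mat n (H * F i * H) (F i)) =
      (\<Sum>r\<in>{..<n} \<times> {..<n}. h (fst r) * h (snd r) * (cmod (Z i $$ r))\<^sup>2)" if i: "i < 3" for i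
  proof -
    note Fi = F[OF i]
    have "mat_adjoint U * (H * F i * H) * U = mat_adjoint U * (H * F i) * (H * U)"
      using U(1) aU H Fi by (simp add: assoc_mult_mat[of _ n n _ n _ n])
    also have "\<dots> = mat_adjoint U * H * F i * (H * U)"
      using U(1) aU H Fi by (simp add: assoc_mult_mat[of _ n n _ n _ n])
    also have "\<dots> = ?D * Z i * ?D"
      unfolding HU UH Z_def using U(1) aU H Fi diag_of_carrier[of n "\<lambda>i. of_real (h i)"]
      by (simp add: assoc_mult_mat[of _ n n _ n _ n])
    finally have eq: "mat_adjoint U * (H * F i * H) * U = ?D * Z i * ?D" .
    have "inner_mat n (H * F i * H) (F i) = inner_mat n (?D * Z i * ?D) (Z i)"
      using inner_mat_conj[OF U(1) U(1) U(3) U(3), of "H * F i * H" "F i"] H Fi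
      unfolding eq by (simp add: Z_def)
    also have "\<dots> = (\<Sum>k<n. \<Sum>l<n. of_real (h k * h l * (cmod (Z i $$ (k, l)))\<^sup>2))"
      unfolding inner_mat_def
    proof (intro sum.cong refl)
      fix k l assume kl: "k \<in> {..<n}" "l \<in> {..<n}"
      have DZ: "?D * Z i \<in> carrier_mat n n" using Z[OF i] diag_of_carrier by (rule mult_carrier_mat[rotated])
      show "(?D * Z i * ?D) $$ (k, l) * cnj (Z i $$ (k, l)) = of_real (h k * h l * (cmod (Z i $$ (k, l)))\<^sup>2)"
        using kl unfolding of_real_mult complex_norm_square
        by (subst mult_diag_index[OF DZ]) (auto simp: diag_mult_index[OF Z[OF i]] simp del: index_mult_mat)
    qed
    also have "\<dots> = of_real (\<Sum>r\<in>{..<n} \<times> {..<n}. h (fst r) * h (snd r) * (cmod (Z i $$ r))\<^sup>2)"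
      by (simp add: sum.cartesian_product case_prod_unfold)
    finally show ?thesis by simp
  qed
  have HH: "Re (inner_mat n H H) = (\<Sum>i<n. (h i)\<^sup>2)"
  proof -
    have "mat_adjoint U * H * U = ?D * (mat_adjoint U * U)"
      unfolding UH by (rule assoc_mult_mat[OF diag_of_carrier aU U(1)])
    then have "mat_adjoint U * H * U = ?D" using U(2) by (simp add: right_mult_one_mat[OF diag_of_carrier])
    then have "inner_mat n H H = inner_mat n ?D ?D"
      using inner_mat_conj[OF U(1) U(1) U(3) U(3) H H] by simp
    also have "\<dots> = (\<Sum>i<n. \<Sum>j<n. if j = i then of_real ((h i)\<^sup>2) else 0)"
      unfolding inner_mat_def by (intro sum.cong) (auto simp: diag_of_def power2_eq_square)
    finally show ?thesis by simp
  qed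
  define v where "v r = (cmod (Z 0 $$ r))\<^sup>2" for r
  define w where "w r = (\<Sum>i<3. (cmod (Z i $$ r))\<^sup>2)" for r
  have Z1: "(\<Sum>r\<in>{..<n} \<times> {..<n}. (cmod (Z i $$ r))\<^sup>2) = 1" if "i < 3" for i
    using arg_cong[OF Zon[OF that that], of Re] unfolding inner_mat_self
    by (simp add: sum.cartesian_product case_prod_unfold)
  have "(\<Sum>r\<in>{..<n} \<times> {..<n}. - (h (fst r) * h (snd r)) * (v r + w r)) \<le> sqrt 10 / 2 * (\<Sum>i<n. (h i)\<^sup>2)"
  proof (rule weighted_products_bound[OF n])
    show "(\<Sum>r\<in>{..<n} \<times> {..<n}. w r) = 3"
      unfolding w_def by (subst sum.swap) (simp add: Z1)
    fix r assume "r \<in> {..<n} \<times> {..<n}"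
    then show "0 \<le> w r \<and> w r \<le> 1"
      using bessel_entry[of 3 Z n "fst r" "snd r"] Z Zon by (auto simp: w_def intro: sum_nonneg)
  qed (use Z1[of 0] in \<open>auto simp: v_def\<close>)
  also have "(\<Sum>r\<in>{..<n} \<times> {..<n}. - (h (fst r) * h (snd r)) * (v r + w r)) =
      - (Re (inner_mat n (H * F 0 * H) (F 0)) + (\<Sum>i<3. Re (inner_mat n (H * F i * H) (F i))))"
  proof -
    have "(\<Sum>i<3. Re (inner_mat n (H * F i * H) (F i))) = (\<Sum>r\<in>{..<n} \<times> {..<n}. h (fst r) * h (snd r) * w r)"
      unfolding w_def sum_distrib_left by (subst sum.swap) (simp add: form)
    then show ?thesis by (simp add: form v_def distrib_left sum.distrib sum_negf sum_subtractf)
  qed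
  finally show ?thesis by (simp add: HH)
qed

section \<open>The terms without interaction\<close>

lemma gram_diagonal:
  assumes M: "M \<in> carrier_mat n n" and i: "i < n"
  shows "(mat_adjoint M * M) $$ (i, i) = of_real (\<Sum>k<n. (cmod (M $$ (k, i)))\<^sup>2)"
  unfolding mult_index[OF adjoint_carrier[OF M] M i i] of_real_sum complex_norm_square
  using i by (simp add: adjoint_index[OF M] mult.commute)

lemma squared_singular_values:
  assumes X: "X \<in> carrier_mat n n"
  obtains U a where "U \<in> carrier_mat n n" "mat_adjoint U * U = 1\<^sub>m n" "U * mat_adjoint U = 1\<^sub>m n"
    "mat_adjoint X * X * U = U * diag_of n (\<lambda>i. of_real (a i))"
    "mat_adjoint U * (mat_adjoint X * X) = diag_of n (\<lambda>i. of_real (a i)) * mat_adjoint U"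
    "\<And>i. i < n \<Longrightarrow> a i \<ge> 0" "(\<Sum>i<n. a i) = Re (inner_mat n X X)"
proof -
  note aX = adjoint_carrier[OF X]
  have A: "mat_adjoint X * X \<in> carrier_mat n n" using aX X by (rule mult_carrier_mat)
  have herm: "mat_adjoint (mat_adjoint X * X) = mat_adjoint X * X"
    using adjoint_mult[OF aX X] by (simp add: adjoint_adjoint[OF X])
  obtain U a where U: "U \<in> carrier_mat n n" "mat_adjoint U * U = 1\<^sub>m n" "U * mat_adjoint U = 1\<^sub>m n"
    and AU: "mat_adjoint X * X * U = U * diag_of n (\<lambda>i. of_real (a i))"
    and UA: "mat_adjoint U * (mat_adjoint X * X) = diag_of n (\<lambda>i. of_real (a i)) * mat_adjoint U"
    using hermitian_diagonalization_real[OF A herm] by blast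
  note aU = adjoint_carrier[OF U(1)]
  have XU: "X * U \<in> carrier_mat n n" using X U(1) by (rule mult_carrier_mat)
  have "mat_adjoint (X * U) * (X * U) = mat_adjoint U * (mat_adjoint X * X * U)"
    using X aX U(1) aU by (simp add: adjoint_mult assoc_mult_mat[of _ n n _ n _ n])
  also have "\<dots> = mat_adjoint U * U * diag_of n (\<lambda>i. of_real (a i))"
    unfolding AU by (rule assoc_mult_mat[OF aU U(1) diag_of_carrier, symmetric])
  also have "\<dots> = diag_of n (\<lambda>i. of_real (a i))"
    unfolding U(2) by (rule left_mult_one_mat[OF diag_of_carrier])
  finally have gram: "mat_adjoint (X * U) * (X * U) = diag_of n (\<lambda>i. of_real (a i))" .
  have a: "a i = (\<Sum>k<n. (cmod ((X * U) $$ (k, i)))\<^sup>2)" if "i < n" for i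
  proof -
    have "complex_of_real (a i) = of_real (\<Sum>k<n. (cmod ((X * U) $$ (k, i)))\<^sup>2)"
      unfolding gram_diagonal[OF XU that, symmetric] gram using that by (simp add: diag_of_def)
    then show ?thesis by (simp only: of_real_eq_iff)
  qed
  show thesis
  proof (rule that[OF U AU UA])
    show "a i \<ge> 0" if "i < n" for i unfolding a[OF that] by (simp add: sum_nonneg)
    have "inner_mat n (X * U) (X * U) = inner_mat n X (X * U * mat_adjoint U)"
      using U(1) X XU by (rule inner_mat_mult_right)
    also have "X * U * mat_adjoint U = X * (U * mat_adjoint U)" using X U(1) aU by (rule assoc_mult_mat)
    finally have "inner_mat n (X * U) (X * U) = inner_mat n X X" using U(3) X by simp
    moreover have "(\<Sum>i<n. a i) = Re (inner_mat n (X * U) (X * U))"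
      unfolding inner_mat_self by (subst sum.swap) (simp add: a del: index_mult_mat)
    ultimately show "(\<Sum>i<n. a i) = Re (inner_mat n X X)" by simp
  qed
qed

text \<open>The largest eigenvalues of \<open>X\<^sup>* X\<close> and \<open>X X\<^sup>*\<close> agree: if \<open>v\<close> is an eigenvector of \<open>X X\<^sup>*\<close> for
  \<open>b\<^sub>j \<noteq> 0\<close>, then \<open>X\<^sup>* v\<close> is an eigenvector of \<open>X\<^sup>* X\<close> for the same value. Column \<open>j\<close> of \<open>W\<close> holds
  the coordinates of \<open>X\<^sup>* v\<close> in the eigenbasis \<open>U\<close>.\<close>

lemma singular_values_adjoint:
  assumes X: "X \<in> carrier_mat n n"
    and U: "U \<in> carrier_mat n n" "mat_adjoint U * U = 1\<^sub>m n" "U * mat_adjoint U = 1\<^sub>m n"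
    and V: "V \<in> carrier_mat n n" "mat_adjoint V * V = 1\<^sub>m n"
    and UA: "mat_adjoint U * (mat_adjoint X * X) = diag_of n (\<lambda>i. of_real (a i)) * mat_adjoint U"
    and BV: "X * mat_adjoint X * V = V * diag_of n (\<lambda>i. of_real (b i))"
    and a0: "\<And>i. i < n \<Longrightarrow> a i \<ge> 0" and j: "j < n"
  shows "\<exists>i<n. b j \<le> a i"
proof -
  note aX = adjoint_carrier[OF X] note aU = adjoint_carrier[OF U(1)] note aV = adjoint_carrier[OF V(1)]
  note assoc = assoc_mult_mat[of _ n n _ n _ n]
  define W where "W = mat_adjoint U * (mat_adjoint X * V)"
  have XV: "mat_adjoint X * V \<in> carrier_mat n n" using aX V(1) by (rule mult_carrier_mat)
  have W: "W \<in> carrier_mat n n" unfolding W_def using aU XV by (rule mult_carrier_mat)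
  let ?Da = "diag_of n (\<lambda>i. of_real (a i))" and ?Db = "diag_of n (\<lambda>i. of_real (b i))"
  have "?Da * W = ?Da * mat_adjoint U * (mat_adjoint X * V)"
    unfolding W_def by (rule assoc_mult_mat[OF diag_of_carrier aU XV, symmetric])
  also have "\<dots> = mat_adjoint U * (mat_adjoint X * (X * mat_adjoint X * V))"
    unfolding UA[symmetric] using aU X aX V(1) by (simp add: assoc)
  also have "\<dots> = W * ?Db"
    unfolding BV W_def using aU X aX V(1) by (simp add: assoc)
  finally have WD: "?Da * W = W * ?Db" .
  have ent: "of_real (a i) * W $$ (i, j) = W $$ (i, j) * of_real (b j)" if "i < n" for i
    using arg_cong[OF WD, of "\<lambda>M. M $$ (i, j)"]
    unfolding diag_mult_index[OF W that j] mult_diag_index[OF W that j] by simp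
  show ?thesis
  proof (cases "\<exists>i<n. W $$ (i, j) \<noteq> 0")
    case True
    then obtain i where "i < n" "W $$ (i, j) \<noteq> 0" by blast
    then have "a i = b j" using ent[of i] by auto
    then show ?thesis using \<open>i < n\<close> by auto
  next
    case False
    have "mat_adjoint W = mat_adjoint V * (X * U)"
      unfolding W_def using aU XV V(1) aV aX X U(1)
      by (simp add: adjoint_mult[of _ n] adjoint_adjoint[of _ n] assoc)
    then have "mat_adjoint W * W = mat_adjoint V * (X * (U * mat_adjoint U) * (mat_adjoint X * V))"
      unfolding W_def using aU XV V(1) aV aX X U(1) by (simp add: assoc)
    also have "\<dots> = mat_adjoint V * (V * ?Db)"
      unfolding U(3) BV[symmetric] using X V(1) aX aV by (simp add: assoc)
    also have "\<dots> = mat_adjoint V * V * ?Db" by (rule assoc_mult_mat[OF aV V(1) diag_of_carrier, symmetric])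
    also have "\<dots> = ?Db" unfolding V(2) by (rule left_mult_one_mat[OF diag_of_carrier])
    finally have "?Db $$ (j, j) = of_real (\<Sum>k<n. (cmod (W $$ (k, j)))\<^sup>2)"
      using gram_diagonal[OF W j] by simp
    then have "b j = 0" using False j by (simp add: diag_of_def)
    then show ?thesis using a0[OF j] j by auto
  qed
qed

text \<open>The form \<open>\<parallel>X Y\<parallel>\<^sup>2 + \<parallel>Y X\<parallel>\<^sup>2\<close> has the eigenvalues \<open>a\<^sub>i + b\<^sub>j\<close>, where \<open>a\<close> and \<open>b\<close> list the
  eigenvalues of \<open>X\<^sup>* X\<close> and \<open>X X\<^sup>*\<close>, that is, two copies of the squared singular values of \<open>X\<close>. Every sum
  other than that of the two maxima is at most the sum of two singular values squared with different
  indices, hence at most \<open>\<parallel>X\<parallel>\<^sup>2\<close>. So it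
  suffices to exclude the single direction \<open>Y0\<close> that belongs to the two maxima.\<close>

lemma product_norms_codimension_one:
  assumes X: "X \<in> carrier_mat n n" and n: "n > 0"
  obtains Y0 where "Y0 \<in> carrier_mat n n"
    "\<And>Y. Y \<in> carrier_mat n n \<Longrightarrow> inner_mat n Y Y0 = 0 \<Longrightarrow>
      Re (inner_mat n (X * Y) (X * Y)) + Re (inner_mat n (Y * X) (Y * X))
        \<le> Re (inner_mat n X X) * Re (inner_mat n Y Y)"
proof -
  note aX = adjoint_carrier[OF X]
  note assoc = assoc_mult_mat[of _ n n _ n _ n]
  obtain U a where U: "U \<in> carrier_mat n n" "mat_adjoint U * U = 1\<^sub>m n" "U * mat_adjoint U = 1\<^sub>m n"
    and AU: "mat_adjoint X * X * U = U * diag_of n (\<lambda>i. of_real (a i))"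
    and UA: "mat_adjoint U * (mat_adjoint X * X) = diag_of n (\<lambda>i. of_real (a i)) * mat_adjoint U"
    and a: "\<And>i. i < n \<Longrightarrow> a i \<ge> 0" "(\<Sum>i<n. a i) = Re (inner_mat n X X)"
    using squared_singular_values[OF X] by blast
  obtain V b where V: "V \<in> carrier_mat n n" "mat_adjoint V * V = 1\<^sub>m n" "V * mat_adjoint V = 1\<^sub>m n"
    and BV: "X * mat_adjoint X * V = V * diag_of n (\<lambda>i. of_real (b i))"
    and VB: "mat_adjoint V * (X * mat_adjoint X) = diag_of n (\<lambda>i. of_real (b i)) * mat_adjoint V"
    and b: "\<And>i. i < n \<Longrightarrow> b i \<ge> 0" "(\<Sum>i<n. b i) = Re (inner_mat n X X)"
    using squared_singular_values[OF aX] unfolding adjoint_adjoint[OF X] inner_mat_adjoint_adjoint[OF X X]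
    by blast
  note aU = adjoint_carrier[OF U(1)] note aV = adjoint_carrier[OF V(1)]
  have ba: "\<exists>i<n. b j \<le> a i" if "j < n" for j
    by (rule singular_values_adjoint[OF X U V(1,2) UA BV a(1) that])
  have ab: "\<exists>i<n. a j \<le> b i" if "j < n" for j
    using singular_values_adjoint[OF aX V U(1,2), of b a j] VB AU b(1) that
    unfolding adjoint_adjoint[OF X] by blast
  obtain i0 where i0: "i0 < n" "\<And>i. i < n \<Longrightarrow> a i \<le> a i0"
  proof -
    have "Max (a ` {..<n}) \<in> a ` {..<n}" using n by (intro Max_in) auto
    then obtain i0 where "i0 < n" "a i0 = Max (a ` {..<n})" by auto
    then show ?thesis using that[of i0] by simp
  qed
  obtain j0 where j0: "j0 < n" "\<And>j. j < n \<Longrightarrow> b j \<le> b j0"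
  proof -
    have "Max (b ` {..<n}) \<in> b ` {..<n}" using n by (intro Max_in) auto
    then obtain j0 where "j0 < n" "b j0 = Max (b ` {..<n})" by auto
    then show ?thesis using that[of j0] by simp
  qed
  have two: "f i + f j \<le> (\<Sum>k<n. f k)" if "i < n" "j < n" "i \<noteq> j" "\<And>k. k < n \<Longrightarrow> f k \<ge> 0" for f :: "nat \<Rightarrow> real" and i j
  proof -
    have "f i + f j = (\<Sum>k\<in>{i, j}. f k)" using that by simp
    also have "\<dots> \<le> (\<Sum>k<n. f k)" using that by (intro sum_mono2) auto
    finally show ?thesis .
  qed
  have sum_le: "a i + b j \<le> Re (inner_mat n X X)" if ij: "i < n" "j < n" "(i, j) \<noteq> (i0, j0)" for i j
  proof (cases "i = i0")
    case False
    obtain i' where "i' < n" "b j \<le> a i'" using ba[OF ij(2)] by blast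
    then have "b j \<le> a i0" using i0(2)[of i'] by simp
    then show ?thesis using two[of i i0 a] ij i0 a False by simp
  next
    case True
    then have "j \<noteq> j0" using ij by simp
    obtain j' where "j' < n" "a i \<le> b j'" using ab[OF ij(1)] by blast
    then have "a i \<le> b j0" using j0(2)[of j'] by simp
    then show ?thesis using two[of j j0 b] ij j0 b \<open>j \<noteq> j0\<close> by simp
  qed
  define E where "E = mat n n (\<lambda>p. if p = (i0, j0) then 1 else 0 :: complex)"
  have E: "E \<in> carrier_mat n n" by (simp add: E_def)
  have innerE: "inner_mat n Z E = Z $$ (i0, j0)" for Z
  proof -
    have "inner_mat n Z E = (\<Sum>i<n. \<Sum>j<n. if j = j0 then if i = i0 then Z $$ (i0, j0) else 0 else 0)"
      unfolding inner_mat_def by (intro sum.cong) (auto simp: E_def)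
    then show ?thesis using i0 j0 by simp
  qed
  show thesis
  proof
    have UE: "U * E \<in> carrier_mat n n" using U(1) E by (rule mult_carrier_mat)
    show Y0: "U * E * mat_adjoint V \<in> carrier_mat n n" using UE aV by (rule mult_carrier_mat)
    fix Y :: "complex mat" assume Y: "Y \<in> carrier_mat n n" and orth: "inner_mat n Y (U * E * mat_adjoint V) = 0"
    define Z where "Z = mat_adjoint U * Y * V"
    have UY: "mat_adjoint U * Y \<in> carrier_mat n n" using aU Y by (rule mult_carrier_mat)
    have Z: "Z \<in> carrier_mat n n" unfolding Z_def using UY V(1) by (rule mult_carrier_mat)
    have "mat_adjoint U * (U * E * mat_adjoint V) * V = (mat_adjoint U * U) * E * (mat_adjoint V * V)"
      using U(1) aU V(1) aV E by (simp add: assoc)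
    then have "mat_adjoint U * (U * E * mat_adjoint V) * V = E"
      unfolding U(2) V(2) using E by simp
    then have "inner_mat n Z E = 0"
      using inner_mat_conj[OF U(1) V(1) U(3) V(3) Y Y0] orth by (simp add: Z_def)
    then have Z0: "Z $$ (i0, j0) = 0" by (simp add: innerE)
    have XY: "X * Y \<in> carrier_mat n n" "Y * X \<in> carrier_mat n n" using X Y by auto
    have "inner_mat n (X * Y) (X * Y) = inner_mat n (mat_adjoint X * (X * Y)) Y"
      using inner_mat_mult_left[OF aX XY(1) Y] by (simp add: adjoint_adjoint[OF X])
    also have "\<dots> = inner_mat n (mat_adjoint U * (mat_adjoint X * (X * Y)) * V) Z"
      unfolding Z_def using aX XY Y by (intro inner_mat_conj[OF U(1) V(1) U(3) V(3), symmetric]) auto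
    also have "mat_adjoint U * (mat_adjoint X * (X * Y)) * V = (mat_adjoint U * (mat_adjoint X * X)) * Y * V"
      using U(1) aU V(1) X aX Y by (simp add: assoc)
    also have "\<dots> = diag_of n (\<lambda>i. of_real (a i)) * Z"
      unfolding UA Z_def using U(1) aU V(1) X aX Y by (simp add: assoc)
    finally have 1: "inner_mat n (X * Y) (X * Y) = inner_mat n (diag_of n (\<lambda>i. of_real (a i)) * Z) Z" .
    have "inner_mat n (Y * X) (Y * X) = inner_mat n (Y * X * mat_adjoint X) Y"
      using inner_mat_mult_right[OF aX XY(2) Y] by (simp add: adjoint_adjoint[OF X])
    also have "\<dots> = inner_mat n (mat_adjoint U * (Y * X * mat_adjoint X) * V) Z"
      unfolding Z_def using aX XY Y by (intro inner_mat_conj[OF U(1) V(1) U(3) V(3), symmetric]) auto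
    also have "mat_adjoint U * (Y * X * mat_adjoint X) * V = mat_adjoint U * Y * (X * mat_adjoint X * V)"
      using U(1) aU V(1) X aX Y by (simp add: assoc)
    also have "\<dots> = Z * diag_of n (\<lambda>i. of_real (b i))"
      unfolding BV Z_def using U(1) aU V(1) X aX Y by (simp add: assoc)
    finally have 2: "inner_mat n (Y * X) (Y * X) = inner_mat n (Z * diag_of n (\<lambda>i. of_real (b i))) Z" .
    have YZ: "inner_mat n Y Y = inner_mat n Z Z"
      unfolding Z_def by (rule inner_mat_conj[OF U(1) V(1) U(3) V(3) Y Y, symmetric])
    have "inner_mat n (X * Y) (X * Y) + inner_mat n (Y * X) (Y * X) =
        (\<Sum>i<n. \<Sum>j<n. of_real ((a i + b j) * (cmod (Z $$ (i, j)))\<^sup>2))"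
      unfolding 1 2 unfolding inner_mat_def sum.distrib[symmetric] of_real_mult complex_norm_square
      by (intro sum.cong refl)
        (simp add: diag_mult_index[OF Z] mult_diag_index[OF Z] algebra_simps del: index_mult_mat)
    then have "Re (inner_mat n (X * Y) (X * Y)) + Re (inner_mat n (Y * X) (Y * X)) =
        (\<Sum>i<n. \<Sum>j<n. (a i + b j) * (cmod (Z $$ (i, j)))\<^sup>2)"
      unfolding plus_complex.sel(1)[symmetric] by (simp only: Re_sum Re_complex_of_real)
    also have "\<dots> \<le> (\<Sum>i<n. \<Sum>j<n. Re (inner_mat n X X) * (cmod (Z $$ (i, j)))\<^sup>2)"
    proof (intro sum_mono)
      fix i j assume "i \<in> {..<n}" "j \<in> {..<n}"
      then show "(a i + b j) * (cmod (Z $$ (i, j)))\<^sup>2 \<le> Re (inner_mat n X X) * (cmod (Z $$ (i, j)))\<^sup>2"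
        using sum_le[of i j] Z0 by (cases "(i, j) = (i0, j0)") (auto intro: mult_right_mono)
    qed
    also have "\<dots> = Re (inner_mat n X X) * Re (inner_mat n Y Y)"
      unfolding YZ inner_mat_self[of n Z] by (simp add: sum_distrib_left)
    finally show "Re (inner_mat n (X * Y) (X * Y)) + Re (inner_mat n (Y * X) (Y * X))
        \<le> Re (inner_mat n X X) * Re (inner_mat n Y Y)" .
  qed
qed

section \<open>Eigenvalues of the double commutator map\<close>

lemma T_op_self_adjoint:
  assumes X: "X \<in> carrier_mat n n" and Y: "Y \<in> carrier_mat n n" and Z: "Z \<in> carrier_mat n n"
  shows "inner_mat n (T_op X Y) Z = inner_mat n Y (T_op X Z)"
    and "inner_mat n (T_op X Y) Z = inner_mat n (commutator X Y) (commutator X Z)"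
proof -
  have 1: "inner_mat n (T_op X Y) Z = inner_mat n (commutator X Y) (commutator X Z)"
    if "Y \<in> carrier_mat n n" "Z \<in> carrier_mat n n" for Y Z
    unfolding T_op_def by (rule inner_mat_adjoint[OF X that(2) commutator_carrier[OF X that(1)]])
  show "inner_mat n (T_op X Y) Z = inner_mat n Y (T_op X Z)"
    unfolding 1[OF Y Z] inner_mat_cnj[of n "T_op X Z" Y, symmetric] 1[OF Z Y] by (rule inner_mat_cnj[symmetric])
  show "inner_mat n (T_op X Y) Z = inner_mat n (commutator X Y) (commutator X Z)" by (rule 1[OF Y Z])
qed

lemma inner_mat_vectorize:
  "inner_mat n Y Z = (\<Sum>c<n * n. vectorize n Y $ c * cnj (vectorize n Z $ c))"
  unfolding inner_mat_def sum_div_mod[symmetric] by (intro sum.cong) (auto simp: vectorize_def)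

lemma mat_eq_vectorizeI:
  assumes Y: "Y \<in> carrier_mat n n" and Z: "Z \<in> carrier_mat n n" and eq: "vectorize n Y = vectorize n Z"
  shows "Y = Z"
proof (rule eq_matI)
  fix i j assume "i < dim_row Z" "j < dim_col Z"
  then have ij: "i < n" "j < n" using Z by auto
  have "i * n + j < Suc i * n" using ij by simp
  also have "\<dots> \<le> n * n" using ij by (intro mult_right_mono) auto
  finally show "Y $$ (i, j) = Z $$ (i, j)"
    using arg_cong[OF eq, of "\<lambda>v. v $ (i * n + j)"] ij by (simp add: vectorize_def)
qed (use Y Z in auto)

lemma adjoint_matrix_of_T_op:
  assumes X: "X \<in> carrier_mat n n"
  shows "mat_adjoint (matrix_of_op n (T_op X)) = matrix_of_op n (T_op X)"
proof -
  let ?M = "matrix_of_op n (T_op X)"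
  have M: "?M \<in> carrier_mat (n * n) (n * n)" by (simp add: matrix_of_op_def)
  have uc: "unit_matrix n c \<in> carrier_mat n n" for c by (simp add: unit_matrix_def)
  have ent: "?M $$ (r, c) = inner_mat n (T_op X (unit_matrix n c)) (unit_matrix n r)"
    if rc: "r < n * n" "c < n * n" for r c
  proof -
    have n: "n > 0" using rc by (cases n) auto
    have "inner_mat n (T_op X (unit_matrix n c)) (unit_matrix n r) =
        (\<Sum>i<n. \<Sum>j<n. if j = r mod n then if i = r div n then T_op X (unit_matrix n c) $$ (r div n, r mod n) else 0 else 0)"
      unfolding inner_mat_def by (intro sum.cong) (auto simp: unit_matrix_def)
    also have "\<dots> = ?M $$ (r, c)"
      using rc n by (simp add: less_mult_imp_div_less matrix_of_op_def vectorize_def)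
    finally show ?thesis by simp
  qed
  show ?thesis
  proof (rule eq_matI)
    fix r c assume "r < dim_row ?M" "c < dim_col ?M"
    then have rc: "r < n * n" "c < n * n" using M by auto
    show "mat_adjoint ?M $$ (r, c) = ?M $$ (r, c)"
      unfolding adjoint_index[OF M rc] ent[OF rc] ent[OF rc(2,1)] inner_mat_cnj
      by (rule T_op_self_adjoint(1)[OF X uc uc, symmetric])
  qed (use carrier_matD[OF M] carrier_matD[OF adjoint_carrier[OF M]] in auto)
qed

lemma T_op_eigenbasis:
  assumes X: "X \<in> carrier_mat n n"
  obtains E where "\<And>r. E r \<in> carrier_mat n n"
    "\<And>r s. r < n * n \<Longrightarrow> s < n * n \<Longrightarrow> inner_mat n (E r) (E s) = (if r = s then 1 else 0)"
    "\<And>r. r < n * n \<Longrightarrow> T_op X (E r) = of_real (eigenvalue_T n X (r + 1)) \<cdot>\<^sub>m E r"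
    "\<And>Y Z. inner_mat n Y Z = (\<Sum>r<n * n. inner_mat n Y (E r) * cnj (inner_mat n Z (E r)))"
proof -
  let ?M = "matrix_of_op n (T_op X)" and ?es = "eigenvalues_desc n (T_op X)"
  have M: "?M \<in> carrier_mat (n * n) (n * n)" by (simp add: matrix_of_op_def)
  have cp: "char_poly ?M = (\<Prod>e\<leftarrow>map of_real ?es. [:- e, 1:])"
    using char_poly_T_op(1)[OF X] by (simp add: o_def)
  obtain U where U: "U \<in> carrier_mat (n * n) (n * n)"
    and UU: "mat_adjoint U * U = 1\<^sub>m (n * n)" "U * mat_adjoint U = 1\<^sub>m (n * n)"
    and MU: "?M * U = U * diag_of (n * n) (\<lambda>i. map of_real ?es ! i)"
    using hermitian_diagonalization[OF M adjoint_matrix_of_T_op[OF X] cp] by blast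
  define E where "E r = mat n n (\<lambda>(i, j). U $$ (i * n + j, r))" for r
  have E: "E r \<in> carrier_mat n n" for r by (simp add: E_def)
  have vE: "vectorize n (E r) $ c = U $$ (c, r)" if "c < n * n" for r c
  proof -
    have "n > 0" using that by (cases n) auto
    then show ?thesis using that by (simp add: vectorize_def E_def less_mult_imp_div_less)
  qed
  have inner_E: "inner_mat n Y (E r) = (\<Sum>c<n * n. vectorize n Y $ c * cnj (U $$ (c, r)))" for Y r
    unfolding inner_mat_vectorize by (intro sum.cong) (auto simp: vE)
  show thesis
  proof (rule that[of E])
    fix r assume r: "r < n * n"
    show "T_op X (E r) = of_real (eigenvalue_T n X (r + 1)) \<cdot>\<^sub>m E r"
    proof (rule mat_eq_vectorizeI[of _ n])
      show "vectorize n (T_op X (E r)) = vectorize n (of_real (eigenvalue_T n X (r + 1)) \<cdot>\<^sub>m E r)"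
      proof (rule eq_vecI)
        fix c assume "c < dim_vec (vectorize n (of_real (eigenvalue_T n X (r + 1)) \<cdot>\<^sub>m E r))"
        then have c: "c < n * n" by (simp add: vectorize_def)
        then have n: "n > 0" by (cases n) auto
        have "vectorize n (T_op X (E r)) $ c = (?M *\<^sub>v vectorize n (E r)) $ c"
          unfolding matrix_of_op_T_op[OF X E] ..
        also have "\<dots> = (\<Sum>k<n * n. ?M $$ (c, k) * U $$ (k, r))"
          using c M vE by (auto simp: scalar_prod_def vectorize_def lessThan_atLeast0 intro!: sum.cong)
        also have "\<dots> = (?M * U) $$ (c, r)" by (rule mult_index[OF M U c r, symmetric])
        also have "\<dots> = U $$ (c, r) * of_real (?es ! r)"
          unfolding MU mult_diag_index[OF U c r] using r char_poly_T_op(2)[OF X] by simp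
        also have "\<dots> = vectorize n (of_real (eigenvalue_T n X (r + 1)) \<cdot>\<^sub>m E r) $ c"
          using c n vE[OF c, of r] E[of r]
          by (simp add: vectorize_def eigenvalue_T_def less_mult_imp_div_less)
        finally show "vectorize n (T_op X (E r)) $ c = vectorize n (of_real (eigenvalue_T n X (r + 1)) \<cdot>\<^sub>m E r) $ c" .
      qed (simp add: vectorize_def)
    qed (use E T_op_carrier[OF X E] in auto)
    fix s assume s: "s < n * n"
    have "inner_mat n (E r) (E s) = (mat_adjoint U * U) $$ (s, r)"
      unfolding inner_E mult_index[OF adjoint_carrier[OF U] U s r]
      using s by (intro sum.cong) (auto simp: vE adjoint_index[OF U] mult.commute)
    then show "inner_mat n (E r) (E s) = (if r = s then 1 else 0)" using UU(1) r s by auto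
  next
    fix Y Z
    define N where "N = n * n"
    have "(\<Sum>r<N. inner_mat n Y (E r) * cnj (inner_mat n Z (E r))) =
        (\<Sum>r<N. \<Sum>c<N. \<Sum>d<N. vectorize n Y $ c * cnj (vectorize n Z $ d) * (U $$ (d, r) * cnj (U $$ (c, r))))"
      unfolding inner_E N_def[symmetric] cnj_sum sum_product by (simp add: mult_ac)
    also have "\<dots> = (\<Sum>c<N. \<Sum>r<N. \<Sum>d<N. vectorize n Y $ c * cnj (vectorize n Z $ d) * (U $$ (d, r) * cnj (U $$ (c, r))))"
      by (rule sum.swap)
    also have "\<dots> = (\<Sum>c<N. \<Sum>d<N. \<Sum>r<N. vectorize n Y $ c * cnj (vectorize n Z $ d) * (U $$ (d, r) * cnj (U $$ (c, r))))"
      by (intro sum.cong refl sum.swap)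
    also have "\<dots> = (\<Sum>c<N. \<Sum>d<N. if d = c then vectorize n Y $ c * cnj (vectorize n Z $ c) else 0)"
    proof (intro sum.cong refl)
      fix c d assume "c \<in> {..<N}" "d \<in> {..<N}"
      then have cd: "c < n * n" "d < n * n" by (auto simp: N_def)
      have "(\<Sum>r<N. U $$ (d, r) * cnj (U $$ (c, r))) = (U * mat_adjoint U) $$ (d, c)"
        unfolding N_def mult_index[OF U adjoint_carrier[OF U] cd(2,1)]
        using cd by (intro sum.cong) (auto simp: adjoint_index[OF U])
      also have "\<dots> = (if d = c then 1 else 0)" using UU(2) cd by simp
      finally show "(\<Sum>r<N. vectorize n Y $ c * cnj (vectorize n Z $ d) * (U $$ (d, r) * cnj (U $$ (c, r)))) =
          (if d = c then vectorize n Y $ c * cnj (vectorize n Z $ c) else 0)"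
        by (simp flip: sum_distrib_left)
    qed
    also have "\<dots> = inner_mat n Y Z" unfolding inner_mat_vectorize by (simp add: N_def)
    finally show "inner_mat n Y Z = (\<Sum>r<n * n. inner_mat n Y (E r) * cnj (inner_mat n Z (E r)))"
      by (simp add: N_def)
  qed (rule E)
qed

text \<open>The conjugate-linear map \<open>J Y = [X, Y]\<^sup>*\<close> satisfies \<open>J (J Y) = - T\<^sub>X Y\<close>, so it commutes with
  \<open>T\<^sub>X\<close> and maps each eigenspace into itself.\<close>

lemma T_op_commutator_adjoint:
  assumes X: "X \<in> carrier_mat n n" and Y: "Y \<in> carrier_mat n n"
    and eig: "T_op X Y = of_real a \<cdot>\<^sub>m Y"
  shows "T_op X (mat_adjoint (commutator X Y)) = of_real a \<cdot>\<^sub>m mat_adjoint (commutator X Y)"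
proof -
  note aX = adjoint_carrier[OF X] note aY = adjoint_carrier[OF Y]
  have C: "commutator X Y \<in> carrier_mat n n" by (rule commutator_carrier[OF X Y])
  have swap: "commutator A (c \<cdot>\<^sub>m B) = (- c) \<cdot>\<^sub>m commutator B A" if "A \<in> carrier_mat n n" "B \<in> carrier_mat n n" for A B c
    using that unfolding commutator_def by (auto intro!: eq_matI simp: algebra_simps)
  have one: "1 \<cdot>\<^sub>m B = B" and neg: "(- 1) \<cdot>\<^sub>m (c \<cdot>\<^sub>m B) = (- c) \<cdot>\<^sub>m B"
    for B :: "complex mat" and c by (auto intro!: eq_matI)
  have adj_smult: "mat_adjoint (c \<cdot>\<^sub>m B) = cnj c \<cdot>\<^sub>m mat_adjoint B" if B: "B \<in> carrier_mat n n" for B :: "complex mat" and c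
  proof (rule eq_matI)
    have cB: "c \<cdot>\<^sub>m B \<in> carrier_mat n n" using B by simp
    note aB = adjoint_carrier[OF B]
    fix i j assume "i < dim_row (cnj c \<cdot>\<^sub>m mat_adjoint B)" "j < dim_col (cnj c \<cdot>\<^sub>m mat_adjoint B)"
    then have "i < n" "j < n" using aB by auto
    then show "mat_adjoint (c \<cdot>\<^sub>m B) $$ (i, j) = (cnj c \<cdot>\<^sub>m mat_adjoint B) $$ (i, j)"
      using B aB by (simp add: adjoint_index[OF cB] adjoint_index[OF B])
  qed (use B adjoint_carrier[OF B] adjoint_carrier[of "c \<cdot>\<^sub>m B" n] in auto)
  have "mat_adjoint (commutator (mat_adjoint X) (commutator X Y)) = commutator (mat_adjoint (commutator X Y)) X"
    using adjoint_commutator[OF aX C] by (simp add: adjoint_adjoint[OF X])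
  then have "commutator (mat_adjoint (commutator X Y)) X = of_real a \<cdot>\<^sub>m mat_adjoint Y"
    using eig Y by (simp add: T_op_def adj_smult)
  then have "commutator X (mat_adjoint (commutator X Y)) = (- of_real a) \<cdot>\<^sub>m mat_adjoint Y"
    using swap[OF X adjoint_carrier[OF C], of 1] by (simp add: one neg)
  then have "T_op X (mat_adjoint (commutator X Y)) = of_real a \<cdot>\<^sub>m commutator (mat_adjoint Y) (mat_adjoint X)"
    using swap[OF aX aY, of "- of_real a"] by (simp add: T_op_def)
  then show ?thesis by (simp add: adjoint_commutator[OF X Y])
qed

text \<open>In terms of traces, \<open>tr ([X, Y] Z) = - tr ([X, Z] Y)\<close>.\<close>

lemma commutator_form_antisymmetric:
  assumes X: "X \<in> carrier_mat n n" and Y: "Y \<in> carrier_mat n n" and Z: "Z \<in> carrier_mat n n"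
  shows "inner_mat n (commutator X Y) (mat_adjoint Z) = - inner_mat n (commutator X Z) (mat_adjoint Y)"
proof -
  note aX = adjoint_carrier[OF X] note aY = adjoint_carrier[OF Y] note aZ = adjoint_carrier[OF Z]
  have "inner_mat n (commutator X Y) (mat_adjoint Z) = inner_mat n Y (commutator (mat_adjoint X) (mat_adjoint Z))"
    using inner_mat_adjoint[OF aX aZ Y] by (simp add: adjoint_adjoint[OF X])
  also have "\<dots> = inner_mat n Y (mat_adjoint (commutator Z X))"
    by (simp add: adjoint_commutator[OF Z X])
  also have "\<dots> = inner_mat n (commutator Z X) (mat_adjoint Y)"
    using inner_mat_adjoint_adjoint[OF aY commutator_carrier[OF Z X]] by (simp add: adjoint_adjoint[OF Y])
  also have "\<dots> = - inner_mat n (commutator X Z) (mat_adjoint Y)"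
    using X Z unfolding commutator_def
    by (subst (1 2) inner_mat_diff[of _ n]) auto
  finally show ?thesis .
qed

text \<open>In an eigenbasis of \<open>T\<^sub>X\<close> the bilinear form \<open>tr ([X, Y] Z)\<close> has an antisymmetric matrix \<open>c\<close> that
  links only equal eigenvalues and satisfies \<open>c c\<^sup>* = diag a\<close>. If one of the two gaps
  \<open>a\<^sub>0 > a\<^sub>1\<close> or \<open>a\<^sub>2 > a\<^sub>3\<close> occurred, the leading block of \<open>c\<close> of size 1 or 3 would be an
  antisymmetric matrix with nonzero orthogonal rows, which is impossible in odd size.\<close>

lemma T_op_eigenvalues_pair:
  assumes X: "X \<in> carrier_mat n n" and n: "n \<ge> 2"
  shows "eigenvalue_T n X 1 = eigenvalue_T n X 2" "eigenvalue_T n X 3 = eigenvalue_T n X 4"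
proof -
  define a where "a r = eigenvalue_T n X (r + 1)" for r
  define N where "N = n * n"
  have N: "4 \<le> N" unfolding N_def using mult_le_mono[OF n n] by simp
  have ae: "a r = eigenvalues_desc n (T_op X) ! r" for r by (simp add: a_def eigenvalue_T_def)
  have a0: "a r \<ge> 0" if "r < N" for r
    using char_poly_T_op(2,3)[OF X] that by (simp add: ae N_def)
  have amono: "a s \<le> a r" if "r \<le> s" "s < N" for r s
    using char_poly_T_op(2,4)[OF X] that unfolding ae
    by (cases "r = s") (auto simp: N_def sorted_wrt_iff_nth_less)
  obtain E where E: "\<And>r. E r \<in> carrier_mat n n"
    and on: "\<And>r s. r < N \<Longrightarrow> s < N \<Longrightarrow> inner_mat n (E r) (E s) = (if r = s then 1 else 0)"
    and eig: "\<And>r. r < N \<Longrightarrow> T_op X (E r) = of_real (a r) \<cdot>\<^sub>m E r"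
    and pars: "\<And>Y Z. inner_mat n Y Z = (\<Sum>r<N. inner_mat n Y (E r) * cnj (inner_mat n Z (E r)))"
    using T_op_eigenbasis[OF X] unfolding a_def N_def by blast
  define c where "c r s = inner_mat n (commutator X (E r)) (mat_adjoint (E s))" for r s
  have anti: "c r s = - c s r" for r s
    unfolding c_def by (rule commutator_form_antisymmetric[OF X E E])
  have diag0: "c r r = 0" for r
  proof -
    have "c r r + c r r = 0" by (subst (1) anti[of r r]) simp
    then have "2 * c r r = 0" by (simp only: mult_2)
    then show ?thesis by simp
  qed
  have c_inner: "inner_mat n (mat_adjoint (commutator X (E r))) (E s) = cnj (c r s)" for r s
    using inner_mat_adjoint_adjoint[OF commutator_carrier[OF X E[of r]] adjoint_carrier[OF E[of s]]]
      inner_mat_cnj[of n "commutator X (E r)" "mat_adjoint (E s)"]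
    by (simp add: adjoint_adjoint[OF E] c_def)
  have off: "c r s = 0" if "r < N" "s < N" "a r \<noteq> a s" for r s
  proof -
    let ?W = "mat_adjoint (commutator X (E r))"
    have W: "?W \<in> carrier_mat n n" by (rule adjoint_carrier[OF commutator_carrier[OF X E]])
    have "inner_mat n (T_op X ?W) (E s) = inner_mat n ?W (T_op X (E s))"
      by (rule T_op_self_adjoint(1)[OF X W E])
    then have "of_real (a r) * cnj (c r s) = of_real (a s) * cnj (c r s)"
      unfolding T_op_commutator_adjoint[OF X E eig[OF that(1)]] eig[OF that(2)]
      by (simp add: inner_mat_smult[OF W] inner_mat_smult_right[OF E] c_inner)
    then show ?thesis using that(3) by simp
  qed
  have gram: "(\<Sum>j<N. c s j * cnj (c r j)) = (if r = s then of_real (a r) else 0)" if "r < N" "s < N" for r s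
  proof -
    have "(\<Sum>j<N. c s j * cnj (c r j)) =
        inner_mat n (mat_adjoint (commutator X (E r))) (mat_adjoint (commutator X (E s)))"
      by (subst pars) (simp add: c_inner mult.commute)
    also have "\<dots> = inner_mat n (commutator X (E s)) (commutator X (E r))"
      by (rule inner_mat_adjoint_adjoint[OF commutator_carrier[OF X E] commutator_carrier[OF X E]])
    also have "\<dots> = inner_mat n (T_op X (E s)) (E r)"
      by (rule T_op_self_adjoint(2)[OF X E E, symmetric])
    also have "\<dots> = (if r = s then of_real (a r) else 0)"
      unfolding eig[OF that(2)] using on[OF that(2,1)] by (simp add: inner_mat_smult[OF E])
    finally show ?thesis .
  qed
  have gram_low: "(\<Sum>j<k. c s j * cnj (c r j)) = (if r = s then of_real (a r) else 0)"
    if "r < k" "s < k" "k < N" "a k < a (k - 1)" for r s k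
  proof -
    have "c s j * cnj (c r j) = 0" if "j \<in> {..<N} - {..<k}" for j
    proof -
      have "a j \<le> a k" "a (k - 1) \<le> a s" using that \<open>s < k\<close> \<open>k < N\<close> by (auto intro!: amono)
      then show ?thesis using off[of s j] that \<open>s < k\<close> \<open>k < N\<close> \<open>a k < a (k - 1)\<close> by simp
    qed
    then have "(\<Sum>j<N. c s j * cnj (c r j)) = (\<Sum>j<k. c s j * cnj (c r j))"
      using \<open>k < N\<close> by (intro sum.mono_neutral_right) auto
    then show ?thesis using gram[of r s] that by simp
  qed
  have "a 0 = a 1"
  proof (rule ccontr)
    assume "a 0 \<noteq> a 1"
    then have lt: "a 1 < a 0" using amono[of 0 1] N by simp
    then have "a 0 = 0" using gram_low[of 0 1 0] N diag0[of 0] by simp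
    then show False using lt a0[of 1] N by simp
  qed
  then show "eigenvalue_T n X 1 = eigenvalue_T n X 2" by (simp add: a_def numeral_2_eq_2)
  have "a 2 = a 3"
  proof (rule ccontr)
    assume "a 2 \<noteq> a 3"
    then have lt: "a 3 < a 2" using amono[of 2 3] N by simp
    have g: "c s 0 * cnj (c r 0) + c s 1 * cnj (c r 1) + c s 2 * cnj (c r 2) = (if r = s then of_real (a r) else 0)"
      if "r < 3" "s < 3" for r s
    proof -
      have "{..<3::nat} = {0, 1, 2}" by auto
      then show ?thesis using gram_low[of r 3 s] that lt N by (simp add: add.assoc)
    qed
    have pos: "a 0 \<noteq> 0" "a 1 \<noteq> 0" "a 2 \<noteq> 0"
      using lt a0[of 3] amono[of 0 2] amono[of 1 2] N by auto
    \<comment> \<open>The rows are \<open>(0, x, y)\<close>, \<open>(-x, 0, z)\<close>, \<open>(-y, -z, 0)\<close>. Orthogonality lets at most one of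
      \<open>x\<close>, \<open>y\<close>, \<open>z\<close> be nonzero, but then one row vanishes.\<close>
    have "c 0 1 = 0 \<or> c 0 2 = 0" "c 0 1 = 0 \<or> c 1 2 = 0" "c 0 2 = 0 \<or> c 1 2 = 0"
      using g[of 1 0] g[of 2 0] g[of 2 1] anti[of 1 0] anti[of 2 0] anti[of 2 1] by (auto simp: diag0)
    moreover have "c 0 1 \<noteq> 0 \<or> c 0 2 \<noteq> 0" "c 0 1 \<noteq> 0 \<or> c 1 2 \<noteq> 0" "c 0 2 \<noteq> 0 \<or> c 1 2 \<noteq> 0"
      using g[of 0 0] g[of 1 1] g[of 2 2] pos anti[of 1 0] anti[of 2 0] anti[of 2 1] by (auto simp: diag0)
    ultimately show False by blast
  qed
  then show "eigenvalue_T n X 3 = eigenvalue_T n X 4" by (simp add: a_def)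
qed

section \<open>The bound for the first and third eigenvalue\<close>

text \<open>With \<open>H = (X + X\<^sup>*)/2\<close> and \<open>G = (X - X\<^sup>*)/(2\<i>)\<close> one has
  \<open>H Y H + G Y G = (X Y X\<^sup>* + X\<^sup>* Y X)/2\<close>, and the two terms on the right have conjugate inner
  products with \<open>Y\<close>.\<close>

lemma cartesian_decomposition:
  assumes X: "X \<in> carrier_mat n n"
  obtains H G where "H \<in> carrier_mat n n" "G \<in> carrier_mat n n" "mat_adjoint H = H" "mat_adjoint G = G"
    "\<And>Y. Y \<in> carrier_mat n n \<Longrightarrow> Re (inner_mat n (X * Y * mat_adjoint X) Y) =
        Re (inner_mat n (H * Y * H) Y) + Re (inner_mat n (G * Y * G) Y)"
    "Re (inner_mat n X X) = Re (inner_mat n H H) + Re (inner_mat n G G)"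
proof -
  note aX = adjoint_carrier[OF X]
  define H where "H = mat n n (\<lambda>(i, j). (X $$ (i, j) + cnj (X $$ (j, i))) / 2)"
  define G where "G = mat n n (\<lambda>(i, j). (X $$ (i, j) - cnj (X $$ (j, i))) / (2 * \<i>))"
  define S where "S = X + mat_adjoint X"
  define K where "K = X - mat_adjoint X"
  have car: "H \<in> carrier_mat n n" "G \<in> carrier_mat n n" "S \<in> carrier_mat n n" "K \<in> carrier_mat n n"
    using X aX by (auto simp: H_def G_def S_def K_def)
  have HS: "H = (1 / 2) \<cdot>\<^sub>m S"
    using X aX by (intro eq_matI) (auto simp: H_def S_def adjoint_index[OF X])
  have GK: "G = (1 / (2 * \<i>)) \<cdot>\<^sub>m K"
    using X aX by (intro eq_matI) (auto simp: G_def K_def adjoint_index[OF X])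
  have smult_smult: "c \<cdot>\<^sub>m (d \<cdot>\<^sub>m M) = (c * d) \<cdot>\<^sub>m M" for c d :: complex and M
    by (intro eq_matI) auto
  have scale: "(c \<cdot>\<^sub>m M) * Y * (c \<cdot>\<^sub>m M) = (c * c) \<cdot>\<^sub>m (M * Y * M)"
    if "M \<in> carrier_mat n n" "Y \<in> carrier_mat n n" for c :: complex and M Y
    using that by (simp add: mult_smult_assoc_mat[of _ n n _ n] mult_smult_distrib[of _ n n _ n] smult_smult)
  show thesis
  proof (rule that[OF car(1,2)])
    show "mat_adjoint H = H"
    proof (rule eq_matI)
      fix i j assume "i < dim_row H" "j < dim_col H"
      then have ij: "i < n" "j < n" using car by auto
      then show "mat_adjoint H $$ (i, j) = H $$ (i, j)"
        unfolding adjoint_index[OF car(1) ij] by (simp add: H_def add.commute)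
    qed (use car adjoint_carrier[OF car(1)] in auto)
    show "mat_adjoint G = G"
    proof (rule eq_matI)
      fix i j assume "i < dim_row G" "j < dim_col G"
      then have ij: "i < n" "j < n" using car by auto
      then show "mat_adjoint G $$ (i, j) = G $$ (i, j)"
        unfolding adjoint_index[OF car(2) ij] by (simp add: G_def field_simps)
    qed (use car adjoint_carrier[OF car(2)] in auto)
    fix Y :: "complex mat" assume Y: "Y \<in> carrier_mat n n"
    let ?a = "inner_mat n (X * Y * X) Y" and ?b = "inner_mat n (X * Y * mat_adjoint X) Y"
      and ?c = "inner_mat n (mat_adjoint X * Y * X) Y" and ?d = "inner_mat n (mat_adjoint X * Y * mat_adjoint X) Y"
    have mc: "M * Y * L \<in> carrier_mat n n" "M * Y \<in> carrier_mat n n"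
      if "M \<in> carrier_mat n n" "L \<in> carrier_mat n n" for M L
      using that Y by auto
    have "S * Y * S = (X * Y * X + mat_adjoint X * Y * X) + (X * Y * mat_adjoint X + mat_adjoint X * Y * mat_adjoint X)"
      unfolding S_def using X aX Y
      by (simp add: add_mult_distrib_mat[of _ n n _ _ n] mult_add_distrib_mat[of _ n n _ n])
    then have SS: "inner_mat n (S * Y * S) Y = (?a + ?c) + (?b + ?d)"
      using X aX mc by (simp add: inner_mat_add)
    have "K * Y * K = (X * Y * X - mat_adjoint X * Y * X) - (X * Y * mat_adjoint X - mat_adjoint X * Y * mat_adjoint X)"
      unfolding K_def using X aX Y
      by (simp add: minus_mult_distrib_mat[of _ n n _ _ n] mult_minus_distrib_mat[of _ n n _ n] minus_carrier_mat)
    then have KK: "inner_mat n (K * Y * K) Y = (?a - ?c) - (?b - ?d)"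
      using X aX mc by (simp add: inner_mat_diff minus_carrier_mat)
    have "?c = inner_mat n Y (X * Y * mat_adjoint X)"
    proof -
      have "?c = inner_mat n (mat_adjoint X * Y) (Y * mat_adjoint X)"
        by (rule inner_mat_mult_right[OF X mc(2)[OF aX aX] Y])
      also have "\<dots> = inner_mat n Y (X * (Y * mat_adjoint X))"
        using inner_mat_mult_left[OF aX Y mult_carrier_mat[OF Y aX]] by (simp add: adjoint_adjoint[OF X])
      finally show ?thesis using X Y aX by (simp add: assoc_mult_mat[of _ n n _ n _ n])
    qed
    then have c: "?c = cnj ?b" by (simp add: inner_mat_cnj)
    have HY: "inner_mat n (H * Y * H) Y = (1 / 4) * inner_mat n (S * Y * S) Y"
      unfolding HS scale[OF car(3) Y] using mc[OF car(3) car(3)] by (simp add: inner_mat_smult)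
    have GY: "inner_mat n (G * Y * G) Y = (- 1 / 4) * inner_mat n (K * Y * K) Y"
      unfolding GK scale[OF car(4) Y] using mc[OF car(4) car(4)] by (simp add: inner_mat_smult)
    have "inner_mat n (H * Y * H) Y + inner_mat n (G * Y * G) Y = (?b + cnj ?b) / 2"
      unfolding HY GY SS KK c by (simp add: field_simps)
    then have "Re (inner_mat n (H * Y * H) Y + inner_mat n (G * Y * G) Y) = Re ((?b + cnj ?b) / 2)"
      by (rule arg_cong)
    then show "Re ?b = Re (inner_mat n (H * Y * H) Y) + Re (inner_mat n (G * Y * G) Y)" by simp
  next
    have HH: "inner_mat n H H = (1 / 4) * inner_mat n S S"
      unfolding HS using car by (simp add: inner_mat_smult inner_mat_smult_right)
    have GG: "inner_mat n G G = (1 / 4) * inner_mat n K K"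
      unfolding GK using car by (simp add: inner_mat_smult inner_mat_smult_right)
    have SK: "inner_mat n S S + inner_mat n K K = 2 * inner_mat n X X + 2 * inner_mat n X X"
      unfolding S_def K_def using X aX inner_mat_adjoint_adjoint[OF X X]
      by (simp add: inner_mat_add[of _ n] inner_mat_diff[of _ n] inner_mat_add_right[of _ n] inner_mat_diff_right[of _ n])
    have "inner_mat n H H + inner_mat n G G = inner_mat n X X"
      unfolding HH GG distrib_left[symmetric] SK by simp
    then show "Re (inner_mat n X X) = Re (inner_mat n H H) + Re (inner_mat n G G)"
      by (metis plus_complex.sel(1))
  qed
qed

lemma commutator_norm_expansion:
  assumes X: "X \<in> carrier_mat n n" and Y: "Y \<in> carrier_mat n n"
  shows "Re (inner_mat n (commutator X Y) (commutator X Y)) =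
    Re (inner_mat n (X * Y) (X * Y)) + Re (inner_mat n (Y * X) (Y * X)) - 2 * Re (inner_mat n (X * Y * mat_adjoint X) Y)"
proof -
  have car: "X * Y \<in> carrier_mat n n" "Y * X \<in> carrier_mat n n" using X Y by auto
  have "inner_mat n (X * Y * mat_adjoint X) Y = inner_mat n (X * Y) (Y * X)"
    using inner_mat_mult_right[OF adjoint_carrier[OF X] car(1) Y] by (simp add: adjoint_adjoint[OF X])
  moreover have "Re (inner_mat n (Y * X) (X * Y)) = Re (inner_mat n (X * Y) (Y * X))"
    using inner_mat_cnj[of n "X * Y" "Y * X"] by (metis complex_cnj(1) cnj.sel(1))
  ultimately show ?thesis
    unfolding commutator_def using car
    by (simp add: inner_mat_diff[of _ n] inner_mat_diff_right[of _ n])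
qed

text \<open>One linear condition leaves a space of dimension 3, and it leaves a nonzero vector in the plane
  of the first two coordinates; the basis starts with such a vector.\<close>

lemma orthonormal_triple_in_four_space:
  fixes d :: "nat \<Rightarrow> complex"
  obtains C :: "nat \<Rightarrow> nat \<Rightarrow> complex" where
    "\<And>i j. i < 3 \<Longrightarrow> j < 3 \<Longrightarrow> (\<Sum>r<4. C i r * cnj (C j r)) = (if i = j then 1 else 0)"
    "\<And>i. i < 3 \<Longrightarrow> (\<Sum>r<4. C i r * d r) = 0" "C 0 2 = 0" "C 0 3 = 0"
proof -
  obtain x where x: "(\<Sum>j<4. (cmod (x j))\<^sup>2) = 1"
    "\<And>i::nat. i < 3 \<Longrightarrow> (\<Sum>j<4. (if i = 0 then d j else if j = i + 1 then 1 else 0) * x j) = 0"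
    using homogeneous_system_unit[of 3 4 "\<lambda>i j. if i = 0 then d j else if j = i + 1 then 1 else 0"] by auto
  obtain y where y: "(\<Sum>j<4. (cmod (y j))\<^sup>2) = 1"
    "\<And>i::nat. i < 2 \<Longrightarrow> (\<Sum>j<4. (if i = 0 then d j else cnj (x j)) * y j) = 0"
    using homogeneous_system_unit[of 2 4 "\<lambda>i j. if i = 0 then d j else cnj (x j)"] by auto
  obtain z where z: "(\<Sum>j<4. (cmod (z j))\<^sup>2) = 1"
    "\<And>i::nat. i < 3 \<Longrightarrow> (\<Sum>j<4. (if i = 0 then d j else if i = 1 then cnj (x j) else cnj (y j)) * z j) = 0"
    using homogeneous_system_unit[of 3 4 "\<lambda>i j. if i = 0 then d j else if i = 1 then cnj (x j) else cnj (y j)"] by auto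
  define C where "C i = (if i = 0 then x else if i = 1 then y else z)" for i :: nat
  have unit: "(\<Sum>r<4. f r * cnj (f r)) = 1" if "(\<Sum>j<4. (cmod (f j))\<^sup>2) = 1" for f :: "nat \<Rightarrow> complex"
    unfolding complex_norm_square[symmetric] of_real_sum[symmetric] that by simp
  have flip: "(\<Sum>r<4. f r * cnj (g r)) = 0" if "(\<Sum>r<4. cnj (f r) * g r) = 0" for f g :: "nat \<Rightarrow> complex"
    using arg_cong[OF that, of cnj] by simp
  have orth: "(\<Sum>r<4. cnj (x r) * y r) = 0" "(\<Sum>r<4. cnj (x r) * z r) = 0" "(\<Sum>r<4. cnj (y r) * z r) = 0"
    using y(2)[of 1] z(2)[of 1] z(2)[of 2] by auto
  have c3: "i = 0 \<or> i = 1 \<or> i = 2" if "i < 3" for i :: nat using that by auto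
  show thesis
  proof (rule that[of C])
    fix i j :: nat assume "i < 3" "j < 3"
    then show "(\<Sum>r<4. C i r * cnj (C j r)) = (if i = j then 1 else 0)"
      using c3[of i] c3[of j] unit[OF x(1)] unit[OF y(1)] unit[OF z(1)]
        orth flip[OF orth(1)] flip[OF orth(2)] flip[OF orth(3)]
      by (auto simp: C_def mult.commute)
  next
    fix i :: nat assume "i < 3"
    then show "(\<Sum>r<4. C i r * d r) = 0"
      using c3[of i] x(2)[of 0] y(2)[of 0] z(2)[of 0] by (auto simp: C_def mult.commute)
  next
    have "(\<Sum>j<4. (if j = k then 1 else 0) * x j) = x k" if "k < 4" for k
    proof -
      have "(\<Sum>j<4. (if j = k then 1 else 0) * x j) = (\<Sum>j<4. if j = k then x k else 0)"
        by (intro sum.cong) auto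
      then show ?thesis using that by simp
    qed
    from this[of 2] this[of 3] show "C 0 2 = 0" "C 0 3 = 0"
      using x(2)[of 1] x(2)[of 2] by (auto simp: C_def numeral_2_eq_2 numeral_3_eq_3)
  qed
qed

theorem theorem1p3:
  fixes n :: nat and X :: "complex mat"
  assumes "n \<ge> 2"
    and "X \<in> carrier_mat n n"
    and "frobenius_norm X = 1"
  shows "eigenvalue_T n X 1 + eigenvalue_T n X 3 \<le> (4 + sqrt 10) / 2"
proof -
  note n = assms(1) and X = assms(2)
  note aX = adjoint_carrier[OF X]
  have X1: "Re (inner_mat n X X) = 1" using frobenius_norm_sq[OF X] assms(3) by simp
  define a where "a r = eigenvalue_T n X (r + 1)" for r
  define N where "N = n * n"
  have N: "4 \<le> N" unfolding N_def using mult_le_mono[OF n n] by simp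
  have a01: "a 1 = a 0" "a 3 = a 2"
    using T_op_eigenvalues_pair[OF X n] by (simp_all add: a_def flip: numeral_2_eq_2)
  have a20: "a 2 \<le> a 0"
    using char_poly_T_op(2,4)[OF X] N by (auto simp: a_def eigenvalue_T_def N_def sorted_wrt_iff_nth_less)
  obtain E where E: "\<And>r. E r \<in> carrier_mat n n"
    and on: "\<And>r s. r < N \<Longrightarrow> s < N \<Longrightarrow> inner_mat n (E r) (E s) = (if r = s then 1 else 0)"
    and eig: "\<And>r. r < N \<Longrightarrow> T_op X (E r) = of_real (a r) \<cdot>\<^sub>m E r"
    and pars: "\<And>Y Z. inner_mat n Y Z = (\<Sum>r<N. inner_mat n Y (E r) * cnj (inner_mat n Z (E r)))"
    using T_op_eigenbasis[OF X] unfolding a_def N_def by blast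
  obtain Y0 where Y0: "Y0 \<in> carrier_mat n n"
    and prod: "\<And>Y. Y \<in> carrier_mat n n \<Longrightarrow> inner_mat n Y Y0 = 0 \<Longrightarrow>
      Re (inner_mat n (X * Y) (X * Y)) + Re (inner_mat n (Y * X) (Y * X)) \<le> Re (inner_mat n Y Y)"
    using product_norms_codimension_one[OF X] n X1 by auto
  \<comment> \<open>The rows of \<open>C\<close> are the coordinates, in the first four eigenmatrices, of three orthonormal
    matrices \<open>F i\<close> orthogonal to \<open>Y0\<close>; \<open>F 0\<close> lies in the eigenspace of the top eigenvalue.\<close>
  obtain C :: "nat \<Rightarrow> nat \<Rightarrow> complex" where
    Con: "\<And>i j. i < 3 \<Longrightarrow> j < 3 \<Longrightarrow> (\<Sum>r<4. C i r * cnj (C j r)) = (if i = j then 1 else 0)"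
    and CY0: "\<And>i. i < 3 \<Longrightarrow> (\<Sum>r<4. C i r * inner_mat n (E r) Y0) = 0"
    and C0: "C 0 2 = 0" "C 0 3 = 0"
    using orthonormal_triple_in_four_space[of "\<lambda>r. inner_mat n (E r) Y0"] by blast
  define F where "F i = mat n n (\<lambda>p. \<Sum>r<4. C i r * E r $$ p)" for i
  have F: "F i \<in> carrier_mat n n" for i by (simp add: F_def)
  have inner_F: "inner_mat n (F i) W = (\<Sum>r<4. C i r * inner_mat n (E r) W)" for i W
    unfolding F_def by (rule inner_mat_sum[OF E])
  have FE: "inner_mat n (F i) (E s) = (if s < 4 then C i s else 0)" if "s < N" for i s
  proof -
    have "inner_mat n (F i) (E s) = (\<Sum>r<4. if r = s then C i s else 0)"
      unfolding inner_F using on that N by (intro sum.cong) auto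
    then show ?thesis by simp
  qed
  have FF: "inner_mat n (F i) (F j) = (if i = j then 1 else 0)" if "i < 3" "j < 3" for i j
  proof -
    have "inner_mat n (E r) (F j) = cnj (C j r)" if "r < 4" for r
      using FE[of r j] that N inner_mat_cnj[of n "F j" "E r"] by simp
    then show ?thesis unfolding inner_F using Con[OF that] by simp
  qed
  have TF: "Re (inner_mat n (T_op X (F i)) (F i)) = (\<Sum>r<4. a r * (cmod (C i r))\<^sup>2)" for i
  proof -
    have "inner_mat n (T_op X (F i)) (E r) = of_real (a r) * inner_mat n (F i) (E r)" if "r < N" for r
      unfolding T_op_self_adjoint(1)[OF X F E] eig[OF that] by (simp add: inner_mat_smult_right[OF E])
    then have "inner_mat n (T_op X (F i)) (F i) =
        (\<Sum>r<N. of_real (a r) * (inner_mat n (F i) (E r) * cnj (inner_mat n (F i) (E r))))"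
      by (subst pars) (auto intro!: sum.cong)
    also have "\<dots> = (\<Sum>r<N. of_real (if r < 4 then a r * (cmod (C i r))\<^sup>2 else 0))"
      unfolding complex_norm_square[symmetric] by (intro sum.cong) (auto simp: FE)
    also have "\<dots> = (\<Sum>r<4. of_real (a r * (cmod (C i r))\<^sup>2))"
      using N by (intro sum.mono_neutral_cong_right) auto
    finally show ?thesis by simp
  qed
  have C1: "(\<Sum>r<4. (cmod (C i r))\<^sup>2) = 1" if "i < 3" for i
  proof -
    have "complex_of_real (\<Sum>r<4. (cmod (C i r))\<^sup>2) = 1"
      unfolding of_real_sum complex_norm_square using Con[OF that that] by simp
    then show ?thesis by (simp only: of_real_eq_1_iff)
  qed
  have four: "{..<4::nat} = {0, 1, 2, 3}" by auto
  have T0: "Re (inner_mat n (T_op X (F 0)) (F 0)) = a 0"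
  proof -
    have "Re (inner_mat n (T_op X (F 0)) (F 0)) = a 0 * (\<Sum>r<4. (cmod (C 0 r))\<^sup>2)"
      unfolding TF four using C0 a01 by (simp add: distrib_left)
    then show ?thesis using C1[of 0] by simp
  qed
  have T12: "a 2 \<le> Re (inner_mat n (T_op X (F i)) (F i))" if "i < 3" for i
  proof -
    have "a 2 = (\<Sum>r<4. a 2 * (cmod (C i r))\<^sup>2)" using C1[OF that] by (simp flip: sum_distrib_left)
    also have "\<dots> \<le> (\<Sum>r<4. a r * (cmod (C i r))\<^sup>2)"
    proof (intro sum_mono mult_right_mono)
      fix r assume "r \<in> {..<4::nat}"
      then show "a 2 \<le> a r" unfolding four using a01 a20 by auto
    qed simp
    finally show ?thesis by (simp add: TF)
  qed
  define q where "q i = Re (inner_mat n (X * F i * mat_adjoint X) (F i))" for i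
  have Tq: "Re (inner_mat n (T_op X (F i)) (F i)) \<le> 1 - 2 * q i" if "i < 3" for i
  proof -
    have "Re (inner_mat n (F i) (F i)) = 1" using FF[OF that that] by simp
    moreover have "inner_mat n (F i) Y0 = 0" unfolding inner_F by (rule CY0[OF that])
    ultimately show ?thesis
      using prod[OF F, of i] commutator_norm_expansion[OF X F, of i]
      unfolding T_op_self_adjoint(2)[OF X F F] q_def by simp
  qed
  have "- (q 0 + (\<Sum>i<3. q i)) \<le> sqrt 10 / 2"
  proof -
    obtain H G where HG: "H \<in> carrier_mat n n" "G \<in> carrier_mat n n" "mat_adjoint H = H" "mat_adjoint G = G"
      and q: "\<And>Y. Y \<in> carrier_mat n n \<Longrightarrow> Re (inner_mat n (X * Y * mat_adjoint X) Y) =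
          Re (inner_mat n (H * Y * H) Y) + Re (inner_mat n (G * Y * G) Y)"
      and norm: "Re (inner_mat n X X) = Re (inner_mat n H H) + Re (inner_mat n G G)"
      using cartesian_decomposition[OF X] by blast
    show ?thesis
      using hermitian_compression_bound[OF n HG(1,3) F FF] hermitian_compression_bound[OF n HG(2,4) F FF]
        norm X1
      unfolding q_def q[OF F] sum.distrib
      by (smt (verit) distrib_left mult_cancel_left1)
  qed
  moreover have "(\<Sum>i<3. q i) = q 0 + q 1 + q 2" by (simp add: eval_nat_numeral)
  ultimately have "a 0 + a 2 \<le> 2 + sqrt 10 / 2"
    using T0 T12[of 1] T12[of 2] Tq[of 0] Tq[of 1] Tq[of 2] by simp
  then show ?thesis by (simp add: a_def numeral_3_eq_3 field_simps)
qed

end
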